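(* Let $\varepsilon:=\frac14$. There exists a piecewise polynomial function $F:[0,+\infty)^3\to\mathbb{R}$ with the following properties: - $F$ is supported on $\{(t_1,t_2,t_3)\in[0,\infty)^3:t_1+t_2+t_3\le\frac32\}$; - $F$ is symmetric in $t_1,t_2,t_3$ and not identically zero; - $\int_0^\infty F(t_1,t_2,t_3)\,dt_3=0$ whenever $t_1,t_2\ge0$ and $t_1+t_2>1+\varepsilon$; - the following inequality holds: $$\frac{3\int_{t_1+t_2\le1-\varepsilon}\big(\int_0^\infty F(t_1,t_2,t_3)\,dt_3\big)^2dt_1dt_2}{\int_{[0,\infty)^3}F(t_1,t_2,t_3)^2\,dt_1dt_2dt_3}>2.$$
   Context: In the outer integral of the numerator, $t_1,t_2$ range over $[0,\infty)$ subject to $t_1+t_2\le1-\varepsilon$. *)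

theory Defs
  imports "HOL-Analysis.Analysis"
begin

text \<open>
  Library polyhedra are closed; strict inequalities are also allowed here, so that a set
  can be cut into pairwise disjoint cells that include or omit parts of their boundary.
\<close>

definition polyhedral_cell :: "'a::euclidean_space set \<Rightarrow> bool" where
  "polyhedral_cell C \<longleftrightarrow>
     (\<exists>H. finite H \<and> C = \<Inter>H \<and>
          (\<forall>h\<in>H. \<exists>a b. a \<noteq> 0 \<and> (h = {x. a \<bullet> x \<le> b} \<or> h = {x. a \<bullet> x < b})))"

text \<open>
  The function is prescribed at every point of the set, not just almost everywhere: each
  boundary point belongs to exactly one cell, on which the polynomial representation holds.
  In particular such a function is Borel measurable on the set, and it is bounded there if
  it vanishes outside a bounded subset, so the integrals of such functions over the set and
  over its slices are genuine and never the default value 0 of a non-integrable function.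
\<close>

definition piecewise_polynomial_on :: "'a::euclidean_space set \<Rightarrow> ('a \<Rightarrow> real) \<Rightarrow> bool" where
  "piecewise_polynomial_on S f \<longleftrightarrow>
     (\<exists>\<C>. finite \<C> \<and> partition_on S \<C> \<and>
          (\<forall>C\<in>\<C>. polyhedral_cell C \<and>
                  (\<exists>p. real_polynomial_function p \<and> (\<forall>x\<in>C. f x = p x))))"

definition octant :: "(real \<times> real \<times> real) set" where
  "octant = {(t1, t2, t3). 0 \<le> t1 \<and> 0 \<le> t2 \<and> 0 \<le> t3}"

text \<open>
  A function on the octant is represented by a total function of which only the values on
  the octant are used.
\<close>

definition symmetric_on_octant :: "(real \<times> real \<times> real \<Rightarrow> real) \<Rightarrow> bool" where
  "symmetric_on_octant F \<longleftrightarrow>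
     (\<forall>t1 t2 t3. (t1, t2, t3) \<in> octant \<longrightarrow>
        F (t1, t3, t2) = F (t1, t2, t3) \<and>
        F (t2, t1, t3) = F (t1, t2, t3) \<and>
        F (t2, t3, t1) = F (t1, t2, t3) \<and>
        F (t3, t1, t2) = F (t1, t2, t3) \<and>
        F (t3, t2, t1) = F (t1, t2, t3))"

end

theory Submission
  imports Defs
begin

text \<open>
  Put \<open>T = {y + z \<le> 3/4}\<close>, \<open>R = {x + y + z \<le> 3/2}\<close> and let \<open>J\<close> be the marginal of \<open>F\<close>.
  For any \<open>g\<close> on \<open>T\<close>, \<open>J\<^sup>2 \<ge> 4 J g - 4 g\<^sup>2\<close>, and \<open>3 \<integral>\<^sub>T J g = \<langle>F, S\<rangle>\<close> where \<open>S\<close> is the sum of \<open>g\<close> over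
  the three pairs of coordinates, restricted to \<open>R\<close>. If \<open>F = S - E\<close>, then
  \<open>2 \<langle>F, S\<rangle> - \<parallel>F\<parallel>\<^sup>2 = \<parallel>S\<parallel>\<^sup>2 - \<parallel>E\<parallel>\<^sup>2\<close>, so it suffices that \<open>\<parallel>S\<parallel>\<^sup>2 - \<parallel>E\<parallel>\<^sup>2 > 6 \<parallel>g\<parallel>\<^sup>2\<close>. The optimal \<open>E\<close>
  is the part of \<open>S\<close> orthogonal to the functions with vanishing marginals; it lives where some pair of
  coordinates has sum above \<open>5/4\<close>. A quadratic \<open>g\<close> and a piecewise polynomial approximation of this \<open>E\<close>
  leave enough room.
\<close>

subsection \<open>Piecewise polynomial functions\<close>

text \<open>The bound for \<open>J\<close> is the tangent at \<open>J = 2 g\<close>, with 2 the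
  ratio to be beaten. It spares the computation of \<open>J\<close> on \<open>T\<close>, where a
  fibre crosses many pieces, and the identity for \<open>F = S - E\<close> spares that of the norm
  of \<open>F\<close>. What remains are integrals of squares of single polynomials over polyhedra
  and one product term.

  The obstacle is the choice of \<open>E\<close>. A fibre all of whose points have just one pair of
  coordinates with sum above 5/4 meets no other constrained fibre, and there the projection
  subtracts the mean of \<open>S\<close>. Points with two such pairs, (x, y) and (x, z), occur for x
  > 1; they couple the fibres in both directions, and the exact projection becomes an integral
  equation. A trial function with one free constant replaces its solution: along a fibre the amount
  32 (1/4 - y) (5/4 - x) is moved from the doubly constrained part to the rest. This product form is
  what balances both directions at once.\<close>

lemma halfspace_complement:
  fixes a :: "'a::euclidean_space"
  shows "- {x. a \<bullet> x \<le> b} = {x. (- a) \<bullet> x < - b}" "- {x. a \<bullet> x < b} = {x. (- a) \<bullet> x \<le> - b}"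
  by auto

text \<open>Names the disjunction in \<open>polyhedral_cell\<close>. Unlike the closed halfspaces
  alone, this class is stable under complement, so a cell can be cut into two disjoint
  cells.\<close>

definition open_or_closed_halfspace :: "'a::euclidean_space set \<Rightarrow> bool" where
  "open_or_closed_halfspace h \<longleftrightarrow> (\<exists>a b. a \<noteq> 0 \<and> (h = {x. a \<bullet> x \<le> b} \<or> h = {x. a \<bullet> x < b}))"

lemma open_or_closed_halfspace_Compl:
  "open_or_closed_halfspace h \<Longrightarrow> open_or_closed_halfspace (- h)"
  unfolding open_or_closed_halfspace_def using halfspace_complement
  by (metis neg_equal_0_iff_equal)

text \<open>The adjoint carries the normal vector back; surjectivity keeps it nonzero, as
  \<open>polyhedral_cell\<close> demands.\<close>

lemma open_or_closed_halfspace_vimage: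
  fixes \<pi> :: "'a::euclidean_space \<Rightarrow> 'b::euclidean_space"
  assumes "linear \<pi>" "surj \<pi>" "open_or_closed_halfspace h"
  shows "open_or_closed_halfspace (\<pi> -` h)"
proof -
  obtain a b where a: "a \<noteq> 0" "h = {x. a \<bullet> x \<le> b} \<or> h = {x. a \<bullet> x < b}"
    using assms(3) unfolding open_or_closed_halfspace_def by blast
  have eq: "adjoint \<pi> a \<bullet> x = a \<bullet> \<pi> x" for x
    using adjoint_works[OF assms(1), of x a] by (simp add: inner_commute)
  have "adjoint \<pi> a \<noteq> 0"
  proof
    assume "adjoint \<pi> a = 0"
    then have "a \<bullet> \<pi> x = 0" for x using eq[of x] by simp
    then have "a \<bullet> a = 0" using assms(2) by (metis surjD)
    then show False using a by simp
  qed
  moreover have "\<pi> -` h = {x. adjoint \<pi> a \<bullet> x \<le> b} \<or> \<pi> -` h = {x. adjoint \<pi> a \<bullet> x < b}"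
    using a(2) eq by auto
  ultimately show ?thesis unfolding open_or_closed_halfspace_def by blast
qed

lemma polyhedral_cell_iff:
  "polyhedral_cell C \<longleftrightarrow> (\<exists>H. finite H \<and> C = \<Inter>H \<and> (\<forall>h\<in>H. open_or_closed_halfspace h))"
  unfolding polyhedral_cell_def open_or_closed_halfspace_def by simp

lemma polyhedral_cell_Int:
  assumes "polyhedral_cell A" "polyhedral_cell B" shows "polyhedral_cell (A \<inter> B)"
proof -
  obtain G H where "finite G" "A = \<Inter>G" "\<forall>h\<in>G. open_or_closed_halfspace h"
    "finite H" "B = \<Inter>H" "\<forall>h\<in>H. open_or_closed_halfspace h"
    using assms unfolding polyhedral_cell_iff by blast
  then show ?thesis unfolding polyhedral_cell_iff
    by (intro exI[of _ "G \<union> H"]) auto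
qed

lemma polyhedral_cell_halfspace: "open_or_closed_halfspace h \<Longrightarrow> polyhedral_cell h"
  unfolding polyhedral_cell_iff by (intro exI[of _ "{h}"]) auto

lemma polyhedral_cell_vimage:
  fixes \<pi> :: "'a::euclidean_space \<Rightarrow> 'b::euclidean_space"
  assumes "linear \<pi>" "surj \<pi>" "polyhedral_cell C"
  shows "polyhedral_cell (\<pi> -` C)"
proof -
  obtain H where "finite H" "C = \<Inter>H" "\<forall>h\<in>H. open_or_closed_halfspace h"
    using assms(3) unfolding polyhedral_cell_iff by blast
  then show ?thesis unfolding polyhedral_cell_iff
    by (intro exI[of _ "vimage \<pi> ` H"]) (use open_or_closed_halfspace_vimage[OF assms(1,2)] in auto)
qed

text \<open>\<open>partition_on\<close> excludes the empty block, but refining a partition creates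
  empty intersections. This rule tolerates them by discarding the empty set once and for
  all.\<close>

lemma piecewise_polynomial_onI:
  assumes "finite \<C>" "\<Union>\<C> = S" "\<And>C D. C \<in> \<C> \<Longrightarrow> D \<in> \<C> \<Longrightarrow> C \<noteq> D \<Longrightarrow> C \<inter> D = {}"
    "\<And>C. C \<in> \<C> \<Longrightarrow> polyhedral_cell C"
    "\<And>C. C \<in> \<C> \<Longrightarrow> \<exists>p. real_polynomial_function p \<and> (\<forall>x\<in>C. f x = p x)"
  shows "piecewise_polynomial_on S f"
  unfolding piecewise_polynomial_on_def
  using assms by (intro exI[of _ "\<C> - {{}}"]) (auto simp: partition_on_def disjoint_def)

lemma piecewise_polynomial_onE:
  assumes "piecewise_polynomial_on S f"
  obtains \<C> where "finite \<C>" "partition_on S \<C>" "\<And>C. C \<in> \<C> \<Longrightarrow> polyhedral_cell C"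
      "\<And>C. C \<in> \<C> \<Longrightarrow> \<exists>p. real_polynomial_function p \<and> (\<forall>x\<in>C. f x = p x)"
  using assms unfolding piecewise_polynomial_on_def by metis

lemma piecewise_polynomial_on_poly:
  assumes "polyhedral_cell S" "real_polynomial_function p"
  shows "piecewise_polynomial_on S p"
  using assms by (intro piecewise_polynomial_onI[of "{S}"]) auto

text \<open>On the common refinement of the two partitions both functions are polynomials, so any
  operation that preserves polynomials applies.\<close>

lemma piecewise_polynomial_on_binop:
  fixes f g :: "'a::euclidean_space \<Rightarrow> real"
  assumes "piecewise_polynomial_on S f" "piecewise_polynomial_on S g"
    and op: "\<And>p q :: 'a \<Rightarrow> real. real_polynomial_function p \<Longrightarrow> real_polynomial_function q \<Longrightarrow>
           real_polynomial_function (\<lambda>x. F (p x) (q x))"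
  shows "piecewise_polynomial_on S (\<lambda>x. F (f x) (g x))"
proof -
  obtain \<C> where C: "finite \<C>" "partition_on S \<C>" "\<And>C. C \<in> \<C> \<Longrightarrow> polyhedral_cell C"
      "\<And>C. C \<in> \<C> \<Longrightarrow> \<exists>p. real_polynomial_function p \<and> (\<forall>x\<in>C. f x = p x)"
    using piecewise_polynomial_onE[OF assms(1)] by blast
  obtain \<D> where D: "finite \<D>" "partition_on S \<D>" "\<And>C. C \<in> \<D> \<Longrightarrow> polyhedral_cell C"
      "\<And>C. C \<in> \<D> \<Longrightarrow> \<exists>p. real_polynomial_function p \<and> (\<forall>x\<in>C. g x = p x)"
    using piecewise_polynomial_onE[OF assms(2)] by blast
  let ?E = "(\<lambda>(A, B). A \<inter> B) ` (\<C> \<times> \<D>)"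
  show ?thesis
  proof (rule piecewise_polynomial_onI[of ?E])
    show "finite ?E" using C D by auto
    show "\<Union>?E = S" using C(2) D(2) unfolding partition_on_def by auto
    show "P \<inter> Q = {}" if "P \<in> ?E" "Q \<in> ?E" "P \<noteq> Q" for P Q
    proof -
      obtain A B where A: "P = A \<inter> B" "A \<in> \<C>" "B \<in> \<D>" using \<open>P \<in> ?E\<close> by auto
      obtain A' B' where A': "Q = A' \<inter> B'" "A' \<in> \<C>" "B' \<in> \<D>" using \<open>Q \<in> ?E\<close> by auto
      have "A \<noteq> A' \<or> B \<noteq> B'" using \<open>P \<noteq> Q\<close> A A' by auto
      then have "A \<inter> A' = {} \<or> B \<inter> B' = {}"
        using A A' C(2) D(2) unfolding partition_on_def disjoint_def by blast
      then show ?thesis using A A' by auto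
    qed
    show "polyhedral_cell P" if "P \<in> ?E" for P
      using that C(3) D(3) by (auto intro: polyhedral_cell_Int)
    show "\<exists>p. real_polynomial_function p \<and> (\<forall>x\<in>P. F (f x) (g x) = p x)" if P: "P \<in> ?E" for P
    proof -
      obtain A B where *: "P = A \<inter> B" "A \<in> \<C>" "B \<in> \<D>" using P by auto
      obtain p q where "real_polynomial_function p" "\<forall>x\<in>A. f x = p x"
        "real_polynomial_function q" "\<forall>x\<in>B. g x = q x"
        using C(4)[OF *(2)] D(4)[OF *(3)] by auto
      then show ?thesis using op * by (intro exI[of _ "\<lambda>x. F (p x) (q x)"]) auto
    qed
  qed
qed

lemma piecewise_polynomial_on_add:
  assumes "piecewise_polynomial_on S f" "piecewise_polynomial_on S g"
  shows "piecewise_polynomial_on S (\<lambda>x. f x + g x)"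
  using assms by (rule piecewise_polynomial_on_binop) (rule real_polynomial_function.intros)

lemma piecewise_polynomial_on_diff:
  assumes "piecewise_polynomial_on S f" "piecewise_polynomial_on S g"
  shows "piecewise_polynomial_on S (\<lambda>x. f x - g x)"
  using assms by (rule piecewise_polynomial_on_binop) (rule real_polynomial_function_diff)

lemma piecewise_polynomial_on_restrict:
  assumes "piecewise_polynomial_on S f" "open_or_closed_halfspace h"
  shows "piecewise_polynomial_on S (\<lambda>x. if x \<in> h then f x else 0)"
proof -
  obtain \<C> where C: "finite \<C>" "partition_on S \<C>" "\<And>C. C \<in> \<C> \<Longrightarrow> polyhedral_cell C"
      "\<And>C. C \<in> \<C> \<Longrightarrow> \<exists>p. real_polynomial_function p \<and> (\<forall>x\<in>C. f x = p x)"
    using piecewise_polynomial_onE[OF assms(1)] by blast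
  have disj: "A \<inter> B = {}" if "A \<in> \<C>" "B \<in> \<C>" "A \<noteq> B" for A B
    using C(2) that unfolding partition_on_def disjoint_def by blast
  let ?E = "(\<lambda>A. A \<inter> h) ` \<C> \<union> (\<lambda>A. A \<inter> - h) ` \<C>"
  show ?thesis
  proof (rule piecewise_polynomial_onI[of ?E])
    show "finite ?E" using C by auto
    show "\<Union>?E = S" using C(2) unfolding partition_on_def by auto
    show "P \<inter> Q = {}" if "P \<in> ?E" "Q \<in> ?E" "P \<noteq> Q" for P Q
    proof -
      obtain A B where AB: "A \<in> \<C>" "B \<in> \<C>" "P = A \<inter> h \<or> P = A \<inter> - h" "Q = B \<inter> h \<or> Q = B \<inter> - h"
        using \<open>P \<in> ?E\<close> \<open>Q \<in> ?E\<close> by auto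
      show ?thesis
      proof (cases "A = B")
        case True then show ?thesis using AB \<open>P \<noteq> Q\<close> by auto
      next
        case False then show ?thesis using AB disj[OF AB(1,2)] by auto
      qed
    qed
    show "polyhedral_cell P" if "P \<in> ?E" for P
      using that C(3) polyhedral_cell_halfspace[OF assms(2)]
        polyhedral_cell_halfspace[OF open_or_closed_halfspace_Compl[OF assms(2)]]
      by (auto intro!: polyhedral_cell_Int)
    show "\<exists>p. real_polynomial_function p \<and> (\<forall>x\<in>P. (if x \<in> h then f x else 0) = p x)"
      if P: "P \<in> ?E" for P
    proof -
      from P consider A where "A \<in> \<C>" "P = A \<inter> h" | A where "P = A \<inter> - h" by auto
      then show ?thesis
      proof cases
        case 1 then show ?thesis using C(4)[of A] by auto
      next
        case 2 then show ?thesis by (intro exI[of _ "\<lambda>_. 0"]) (auto intro: real_polynomial_function.intros)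
      qed
    qed
  qed
qed

lemma linear_functional_inner:
  fixes \<phi> :: "'a::euclidean_space \<Rightarrow> real"
  assumes "linear \<phi>"
  shows "\<exists>a. \<forall>x. \<phi> x = a \<bullet> x"
proof (intro exI[of _ "adjoint \<phi> 1"] allI)
  show "\<phi> x = adjoint \<phi> 1 \<bullet> x" for x
    using adjoint_works[OF assms, of x 1] by (simp add: inner_commute)
qed

lemma piecewise_polynomial_on_if_le:
  fixes \<phi> :: "'a::euclidean_space \<Rightarrow> real"
  assumes "piecewise_polynomial_on S f" "linear \<phi>"
  shows "piecewise_polynomial_on S (\<lambda>x. if \<phi> x \<le> b then f x else 0)"
    and "piecewise_polynomial_on S (\<lambda>x. if \<phi> x < b then f x else 0)"
proof -
  obtain a where "\<forall>x. \<phi> x = a \<bullet> x" using linear_functional_inner[OF assms(2)] ..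
  then have a: "\<phi> = (\<lambda>x. a \<bullet> x)" by auto
  have zero: "piecewise_polynomial_on S (\<lambda>_. 0)"
    using piecewise_polynomial_on_diff[OF assms(1) assms(1)] by simp
  have "piecewise_polynomial_on S (\<lambda>x. if x \<in> {x. a \<bullet> x \<le> b} then f x else 0)
      \<and> piecewise_polynomial_on S (\<lambda>x. if x \<in> {x. a \<bullet> x < b} then f x else 0)"
  \<comment> \<open>A zero normal gives no halfspace, but then the condition does not depend on
    \<open>x\<close> and the result is \<open>f\<close> or 0.\<close>
  proof (cases "a = 0")
    case True then show ?thesis using assms(1) zero
      by (cases "0 \<le> b"; cases "0 < b") auto
  next
    case False
    then have "open_or_closed_halfspace {x. a \<bullet> x \<le> b}" "open_or_closed_halfspace {x. a \<bullet> x < b}"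
      unfolding open_or_closed_halfspace_def by auto
    then show ?thesis using piecewise_polynomial_on_restrict[OF assms(1)] by blast
  qed
  then show "piecewise_polynomial_on S (\<lambda>x. if \<phi> x \<le> b then f x else 0)"
    "piecewise_polynomial_on S (\<lambda>x. if \<phi> x < b then f x else 0)"
    by (simp_all add: a)
qed

lemma piecewise_polynomial_on_linear_compose:
  fixes f :: "'a::euclidean_space \<Rightarrow> real"
  assumes "piecewise_polynomial_on S f" "linear \<pi>" "surj \<pi>" "\<pi> -` S = S"
  shows "piecewise_polynomial_on S (\<lambda>x. f (\<pi> x))"
proof -
  obtain \<C> where C: "finite \<C>" "partition_on S \<C>" "\<And>C. C \<in> \<C> \<Longrightarrow> polyhedral_cell C"
      "\<And>C. C \<in> \<C> \<Longrightarrow> \<exists>p. real_polynomial_function p \<and> (\<forall>x\<in>C. f x = p x)"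
    using piecewise_polynomial_onE[OF assms(1)] by blast
  have pol: "polynomial_function \<pi>"
    using assms(2) by (simp add: polynomial_function_bounded_linear linear_conv_bounded_linear)
  show ?thesis
  proof (rule piecewise_polynomial_onI[of "vimage \<pi> ` \<C>"])
    show "finite (vimage \<pi> ` \<C>)" using C by auto
    show "\<Union>(vimage \<pi> ` \<C>) = S" using C(2) assms(4) unfolding partition_on_def by auto
    show "P \<inter> Q = {}" if "P \<in> vimage \<pi> ` \<C>" "Q \<in> vimage \<pi> ` \<C>" "P \<noteq> Q" for P Q
      using that C(2) unfolding partition_on_def disjoint_def by blast
    show "polyhedral_cell P" if "P \<in> vimage \<pi> ` \<C>" for P
      using that C(3) assms(2,3) by (auto intro!: polyhedral_cell_vimage)
    show "\<exists>p. real_polynomial_function p \<and> (\<forall>x\<in>P. f (\<pi> x) = p x)" if "P \<in> vimage \<pi> ` \<C>" for P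
    proof -
      obtain A where A: "A \<in> \<C>" "P = \<pi> -` A" using \<open>P \<in> _\<close> by auto
      obtain p where "real_polynomial_function p" "\<forall>x\<in>A. f x = p x" using C(4)[OF A(1)] by blast
      then show ?thesis using real_polynomial_function_compose[OF pol, of p] A
        by (intro exI[of _ "p \<circ> \<pi>"]) auto
    qed
  qed
qed

subsection \<open>Bounded measurable functions of bounded support\<close>

text \<open>A common home for all the integrands, closed under taking sections and marginals, so that
  every application of Fubini's theorem is unconditional.\<close>

definition tame :: "('a::euclidean_space \<Rightarrow> real) \<Rightarrow> bool" where
  "tame f \<longleftrightarrow> f \<in> borel_measurable borel \<and> bounded (range f) \<and> bounded {t. f t \<noteq> 0}"

lemma tame_measurable [measurable_dest]: "tame f \<Longrightarrow> f \<in> borel_measurable borel"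
  by (simp add: tame_def)

lemma tameE:
  assumes "tame f"
  obtains B a b where "\<And>t. \<bar>f t\<bar> \<le> B" "\<And>t. t \<notin> cbox a b \<Longrightarrow> f t = 0" "0 \<le> B"
proof -
  obtain B where B: "\<bar>f t\<bar> \<le> B" for t using assms unfolding tame_def bounded_iff by auto
  obtain a where "{t. f t \<noteq> 0} \<subseteq> cbox (-a) a"
    using assms bounded_subset_cbox_symmetric unfolding tame_def by blast
  then show thesis using that[of B "-a" a] B[of undefined] order_trans[OF abs_ge_zero B] B by blast
qed

lemma tameI:
  assumes "f \<in> borel_measurable borel" "\<And>t. \<bar>f t\<bar> \<le> B" "\<And>t. t \<notin> cbox a b \<Longrightarrow> f t = 0"
  shows "tame f"
  unfolding tame_def
proof (intro conjI)
  show "bounded (range f)" using assms(2) by (auto simp: bounded_iff)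
  show "bounded {t. f t \<noteq> 0}" by (rule bounded_subset[OF bounded_cbox[of a b]]) (use assms(3) in auto)
qed fact

lemma tame_integrable:
  assumes "tame f" shows "integrable lborel f"
proof -
  obtain B a b where *: "\<And>t. \<bar>f t\<bar> \<le> B" "\<And>t. t \<notin> cbox a b \<Longrightarrow> f t = 0" "0 \<le> B"
    using tameE[OF assms] by blast
  show ?thesis
  proof (rule Bochner_Integration.integrable_bound)
    show "integrable lborel (\<lambda>t. B * indicator (cbox a b) t)"
      by (intro integrable_mult_right integrable_real_indicator)
         (auto simp: emeasure_lborel_cbox_eq)
    show "f \<in> borel_measurable lborel" using assms by (simp add: tame_def)
    show "AE t in lborel. norm (f t) \<le> norm (B * indicator (cbox a b) t)"
      using * by (auto intro!: AE_I2 simp: indicator_def)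
  qed
qed

lemma tame_add: assumes "tame f" "tame g" shows "tame (\<lambda>t. f t + g t)"
  unfolding tame_def
proof (intro conjI)
  show "(\<lambda>t. f t + g t) \<in> borel_measurable borel"
    by (intro borel_measurable_add tame_measurable assms)
  show "bounded (range (\<lambda>t. f t + g t))"
    using assms bounded_plus_comp[of f UNIV g] by (simp add: tame_def)
  have "bounded ({t. f t \<noteq> 0} \<union> {t. g t \<noteq> 0})" using assms by (simp add: tame_def)
  then show "bounded {t. f t + g t \<noteq> 0}" by (rule bounded_subset) auto
qed

lemma tame_cmult: assumes "tame f" shows "tame (\<lambda>t. c * f t)"
  unfolding tame_def
proof (intro conjI)
  show "(\<lambda>t. c * f t) \<in> borel_measurable borel"
    by (intro borel_measurable_times borel_measurable_const tame_measurable assms)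
  show "bounded (range (\<lambda>t. c * f t))"
    using bounded_scaling[of "range f" c] assms by (simp add: tame_def image_image)
  have "bounded {t. f t \<noteq> 0}" using assms unfolding tame_def by blast
  then show "bounded {t. c * f t \<noteq> 0}" by (rule bounded_subset) auto
qed

lemma tame_diff: assumes "tame f" "tame g" shows "tame (\<lambda>t. f t - g t)"
  using tame_add[OF assms(1) tame_cmult[OF assms(2), of "-1"]] by simp

lemma tame_mult: assumes "tame f" "tame g" shows "tame (\<lambda>t. f t * g t)"
proof -
  obtain B a b where *: "\<And>t. \<bar>f t\<bar> \<le> B" "\<And>t. t \<notin> cbox a b \<Longrightarrow> f t = 0" "0 \<le> B"
    using tameE[OF assms(1)] by blast
  obtain C c d where C: "\<And>t. \<bar>g t\<bar> \<le> C" "\<And>t. t \<notin> cbox c d \<Longrightarrow> g t = 0" "0 \<le> C"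
    using tameE[OF assms(2)] by blast
  show ?thesis
  proof (rule tameI)
    show "(\<lambda>t. f t * g t) \<in> borel_measurable borel"
      by (intro borel_measurable_times tame_measurable assms)
    show "\<bar>f t * g t\<bar> \<le> B * C" for t
      unfolding abs_mult using * C by (intro mult_mono) auto
    show "f t * g t = 0" if "t \<notin> cbox a b" for t using * that by simp
  qed
qed

lemma tame_power2: "tame f \<Longrightarrow> tame (\<lambda>t. (f t)\<^sup>2)"
  using tame_mult[of f f] by (simp add: power2_eq_square)

lemma tame_section: assumes "tame f" shows "tame (\<lambda>y. f (x, y))"
proof -
  obtain B a b where *: "\<And>t. \<bar>f t\<bar> \<le> B" "\<And>t. t \<notin> cbox a b \<Longrightarrow> f t = 0" "0 \<le> B"
    using tameE[OF assms] by blast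
  obtain a1 a2 b1 b2 where "a = (a1, a2)" "b = (b1, b2)" by (meson surj_pair)
  then have ab: "cbox a b = cbox a1 b1 \<times> cbox a2 b2" by (simp add: cbox_Pair_eq)
  show ?thesis
  proof (rule tameI)
    have "(\<lambda>y. (x, y)) \<in> borel_measurable borel"
      by (intro borel_measurable_continuous_onI continuous_intros)
    then show "(\<lambda>y. f (x, y)) \<in> borel_measurable borel"
      using assms by (auto simp: tame_def intro: measurable_compose)
    show "\<bar>f (x, y)\<bar> \<le> B" for y using * by simp
    show "f (x, y) = 0" if "y \<notin> cbox a2 b2" for y using * ab that by simp
  qed
qed

lemma tame_swap: assumes "tame f" shows "tame (\<lambda>(x, y). f (y, x))"
proof -
  obtain B a b where *: "\<And>t. \<bar>f t\<bar> \<le> B" "\<And>t. t \<notin> cbox a b \<Longrightarrow> f t = 0" "0 \<le> B"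
    using tameE[OF assms] by blast
  obtain a1 a2 b1 b2 where "a = (a1, a2)" "b = (b1, b2)" by (meson surj_pair)
  then have ab: "cbox a b = cbox a1 b1 \<times> cbox a2 b2" by (simp add: cbox_Pair_eq)
  show ?thesis
  proof (rule tameI)
    have "prod.swap \<in> borel_measurable borel"
      by (intro borel_measurable_continuous_onI continuous_intros)
    from measurable_compose[OF this, of f borel]
    show "(\<lambda>(x, y). f (y, x)) \<in> borel_measurable borel"
      using assms by (simp add: tame_def prod.swap_def case_prod_beta')
    show "\<bar>case t of (x, y) \<Rightarrow> f (y, x)\<bar> \<le> B" for t using * by (simp add: case_prod_beta')
    show "(case t of (x, y) \<Rightarrow> f (y, x)) = 0" if "t \<notin> cbox (a2, a1) (b2, b1)" for t
      using *(2)[of "(snd t, fst t)"] ab that by (cases t) (auto simp: cbox_Pair_eq)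
  qed
qed

text \<open>The supporting box is a product: the volume of its second factor bounds the integral,
  and its first factor contains the support of the marginal.\<close>

lemma tame_marginal: assumes "tame f" shows "tame (\<lambda>x. LINT y|lborel. f (x, y))"
proof -
  obtain B a b where *: "\<And>t. \<bar>f t\<bar> \<le> B" "\<And>t. t \<notin> cbox a b \<Longrightarrow> f t = 0" "0 \<le> B"
    using tameE[OF assms] by blast
  obtain a1 a2 b1 b2 where "a = (a1, a2)" "b = (b1, b2)" by (meson surj_pair)
  then have ab: "cbox a b = cbox a1 b1 \<times> cbox a2 b2" by (simp add: cbox_Pair_eq)
  show ?thesis
  proof (rule tameI)
    have [measurable]: "f \<in> borel_measurable (lborel \<Otimes>\<^sub>M lborel)"
      using assms by (simp add: tame_def lborel_prod)
    have "(\<lambda>x. LINT y|lborel. f (x, y)) \<in> borel_measurable lborel" by measurable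
    then show "(\<lambda>x. LINT y|lborel. f (x, y)) \<in> borel_measurable borel" by simp
    show "\<bar>LINT y|lborel. f (x, y)\<bar> \<le> (LINT y|lborel. B * indicator (cbox a2 b2) y)" for x
    proof -
      have int: "integrable lborel (\<lambda>y. B * indicator (cbox a2 b2) y)"
        by (intro integrable_mult_right integrable_real_indicator)
         (auto simp: emeasure_lborel_cbox_eq)
      have "norm (LINT y|lborel. f (x, y)) \<le> (LINT y|lborel. norm (f (x, y)))" by simp
      also have "\<dots> \<le> (LINT y|lborel. B * indicator (cbox a2 b2) y)"
        using * ab tame_integrable[OF tame_section[OF assms]] int
        by (intro integral_mono) (auto simp: indicator_def)
      finally show ?thesis by simp
    qed
    show "(LINT y|lborel. f (x, y)) = 0" if "x \<notin> cbox a1 b1" for x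
    proof -
      have "f (x, y) = 0" for y using * ab that by simp
      then show ?thesis by simp
    qed
  qed
qed

lemma tame_Fubini:
  assumes "tame f"
  shows "(LINT t|lborel. f t) = (LINT x|lborel. LINT y|lborel. f (x, y))"
    and "(LINT t|lborel. f t) = (LINT y|lborel. LINT x|lborel. f (x, y))"
proof -
  have int: "integrable (lborel \<Otimes>\<^sub>M lborel) f" using tame_integrable[OF assms] by (simp add: lborel_prod)
  show "(LINT t|lborel. f t) = (LINT x|lborel. LINT y|lborel. f (x, y))"
    using lborel_pair.integral_fst'[OF int] by (simp add: lborel_prod)
  show "(LINT t|lborel. f t) = (LINT y|lborel. LINT x|lborel. f (x, y))"
    using lborel_pair.integral_snd[of "\<lambda>x y. f (x, y)"] int by (simp add: lborel_prod)
qed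

lemma tame_swap_integral:
  "tame f \<Longrightarrow> (LINT t|lborel. f t) = (LINT t|lborel. (case t of (x, y) \<Rightarrow> f (y, x)))"
  using tame_Fubini(1)[of f] tame_Fubini(2)[OF tame_swap[of f]] by simp

text \<open>The pieces enter the class here: a continuous function is bounded on the compact box
  around the cell.\<close>

lemma tame_if:
  assumes "continuous_on UNIV p" "Measurable.pred borel C" "\<And>t. C t \<Longrightarrow> t \<in> cbox a b"
  shows "tame (\<lambda>t. if C t then p t else 0)"
proof -
  have "bounded (p ` cbox a b)"
    by (intro compact_imp_bounded compact_continuous_image continuous_on_subset[OF assms(1)]) auto
  then obtain B where B: "\<And>t. t \<in> cbox a b \<Longrightarrow> \<bar>p t\<bar> \<le> B"
    unfolding bounded_iff by auto
  have [measurable]: "p \<in> borel_measurable borel" "Measurable.pred borel C"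
    using assms by (auto intro: borel_measurable_continuous_onI)
  show ?thesis
  proof (rule tameI)
    show "\<bar>if C t then p t else 0\<bar> \<le> \<bar>B\<bar>" for t
      using B[of t] assms(3)[of t] by auto
    show "(if C t then p t else 0) = 0" if "t \<notin> cbox a b" for t
      using that assms(3)[of t] by auto
  qed measurable
qed

lemma tame_section2: "tame (f :: real \<times> real \<times> real \<Rightarrow> real) \<Longrightarrow> tame (\<lambda>z. f (x, y, z))"
  using tame_section[OF tame_section[of f x], of y] by simp

lemma tame_Fubini3:
  assumes "tame (f :: real \<times> real \<times> real \<Rightarrow> real)"
  shows "(LINT t|lborel. f t) = (LINT x|lborel. LINT y|lborel. LINT z|lborel. f (x, y, z))"
  using tame_Fubini(1)[OF assms] tame_Fubini(1)[OF tame_section[OF assms]] by simp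

section \<open>Permutations of the coordinates\<close>

definition rot :: "real \<times> real \<times> real \<Rightarrow> real \<times> real \<times> real" where
  "rot t = (fst (snd t), snd (snd t), fst t)"

definition flip :: "real \<times> real \<times> real \<Rightarrow> real \<times> real \<times> real" where
  "flip t = (fst t, snd (snd t), fst (snd t))"

lemma rot_simp [simp]: "rot (x, y, z) = (y, z, x)" and flip_simp [simp]: "flip (x, y, z) = (x, z, y)"
  by (simp_all add: rot_def flip_def)

lemma tame_permute:
  assumes "tame f" shows "tame (\<lambda>t. f (rot t))" "tame (\<lambda>t. f (flip t))"
proof -
  obtain B a b where *: "\<And>t. \<bar>f t\<bar> \<le> B" "\<And>t. t \<notin> cbox a b \<Longrightarrow> f t = 0" "0 \<le> B"
    using tameE[OF assms] by blast
  obtain a1 a2 a3 b1 b2 b3 where ab: "a = (a1, a2, a3)" "b = (b1, b2, b3)" by (metis surj_pair)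
  have f: "f \<in> borel_measurable borel" using assms by (simp add: tame_def)
  have "rot \<in> borel_measurable borel" "flip \<in> borel_measurable borel"
    unfolding rot_def flip_def by (intro borel_measurable_continuous_onI continuous_intros)+
  then have m: "(\<lambda>t. f (rot t)) \<in> borel_measurable borel" "(\<lambda>t. f (flip t)) \<in> borel_measurable borel"
    using f by (auto intro: measurable_compose)
  show "tame (\<lambda>t. f (rot t))"
    by (rule tameI[OF m(1), of B "(a3, a1, a2)" "(b3, b1, b2)"])
       (use * *(2)[of "rot t" for t] ab in \<open>force simp: cbox_Pair_eq rot_def\<close>)+
  show "tame (\<lambda>t. f (flip t))"
    by (rule tameI[OF m(2), of B "(a1, a3, a2)" "(b1, b3, b2)"])
       (use * *(2)[of "flip t" for t] ab in \<open>force simp: cbox_Pair_eq flip_def\<close>)+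
qed

text \<open>Invariance comes from the free order of integration in Fubini's theorem: for
  \<open>rot\<close> the first coordinate is integrated innermost, for \<open>flip\<close> the last
  two are exchanged. Together they generate all permutations.\<close>

lemma integral_permute:
  assumes "tame f"
  shows "(LINT t|lborel. f (rot t)) = (LINT t|lborel. f t)"
    and "(LINT t|lborel. f (flip t)) = (LINT t|lborel. f t)"
proof -
  have "(LINT t|lborel. f (rot t)) = (LINT p|lborel. LINT x|lborel. f (rot (x, p)))"
    by (rule tame_Fubini(2)[OF tame_permute(1)[OF assms]])
  also have "\<dots> = (LINT y|lborel. LINT z|lborel. LINT x|lborel. f (y, z, x))"
  proof -
    have "tame (\<lambda>p. LINT x|lborel. f (rot (x, p)))"
      using tame_marginal[OF tame_swap[OF tame_permute(1)[OF assms]]] by simp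
    from tame_Fubini(1)[OF this] show ?thesis by simp
  qed
  also have "\<dots> = (LINT t|lborel. f t)" by (rule tame_Fubini3[OF assms, symmetric])
  finally show "(LINT t|lborel. f (rot t)) = (LINT t|lborel. f t)" .
  have "(LINT t|lborel. f (flip t)) = (LINT x|lborel. LINT p|lborel. f (flip (x, p)))"
    by (rule tame_Fubini(1)[OF tame_permute(2)[OF assms]])
  also have "\<dots> = (LINT x|lborel. LINT p|lborel. f (x, p))"
    using tame_swap_integral[OF tame_section[OF assms]] by (simp add: case_prod_beta' flip_def)
  also have "\<dots> = (LINT t|lborel. f t)" by (rule tame_Fubini(1)[OF assms, symmetric])
  finally show "(LINT t|lborel. f (flip t)) = (LINT t|lborel. f t)" .
qed

text \<open>The end points form a null set, so the values of \<open>h\<close> there are left open;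
  strict and weak inequalities in the pieces therefore integrate alike.\<close>

lemma has_bochner_integral_antiderivative:
  fixes f h \<Phi> :: "real \<Rightarrow> real"
  assumes "a \<le> b"
    and deriv: "\<And>z. (\<Phi> has_real_derivative f z) (at z)" and cont: "continuous_on UNIV f"
    and h: "h \<in> borel_measurable borel" "\<And>z. a < z \<Longrightarrow> z < b \<Longrightarrow> h z = f z"
      "\<And>z. z < a \<or> b < z \<Longrightarrow> h z = 0"
  shows "has_bochner_integral lborel h (\<Phi> b - \<Phi> a)"
proof -
  have "has_bochner_integral lborel (\<lambda>z. indicator {a..b} z *\<^sub>R f z) (\<Phi> b - \<Phi> a)"
    using \<open>a \<le> b\<close> deriv cont
    by (intro has_bochner_integral_FTC_Icc)
       (auto simp: has_real_derivative_iff_has_vector_derivative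
         intro: has_vector_derivative_at_within continuous_on_subset)
  moreover have "AE z in lborel. h z = indicator {a..b} z *\<^sub>R f z"
    using AE_lborel_singleton[of a] AE_lborel_singleton[of b]
    by eventually_elim (use h in \<open>force simp: indicator_def\<close>)
  moreover have "(\<lambda>z. indicator {a..b} z *\<^sub>R f z) \<in> borel_measurable lborel"
    using calculation(1) has_bochner_integral_iff borel_measurable_has_bochner_integral by blast
  ultimately show ?thesis
    using h(1) has_bochner_integral_cong_AE[of h lborel "\<lambda>z. indicator {a..b} z *\<^sub>R f z"] by simp
qed

lemmas lborel_integral_antiderivative =
  has_bochner_integral_antiderivative[THEN has_bochner_integral_integral_eq]

subsection \<open>The function\<close>

text \<open>With \<open>t = 3/4 - y - z\<close> this is \<open>3 + 12 t\<^sup>2 + 3 t - 4 y z\<close>. The ratio of the last two coefficients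
  makes the integral of \<open>g\<close> over \<open>0 \<le> z \<le> u = 3/4 - y\<close> equal to \<open>3 u + 6 u\<^sup>3\<close>, without a term
  \<open>u\<^sup>2\<close>, so that the mean below, \<open>h_poly\<close>, is a polynomial.\<close>

definition g_poly :: "real \<Rightarrow> real \<Rightarrow> real" where
  "g_poly y z = 12 - 21 * (y + z) + 12 * (y\<^sup>2 + z\<^sup>2) + 20 * y * z"

text \<open>The mean of \<open>g_poly y\<close> over the interval from 0 to \<open>l\<close>.\<close>

definition g_mean :: "real \<Rightarrow> real \<Rightarrow> real" where
  "g_mean y l = 12 - 21 * y + 12 * y\<^sup>2 + (10 * y - 21 / 2) * l + 4 * l\<^sup>2"

text \<open>The mean of \<open>S\<close> over the fibre \<open>0 \<le> z \<le> u + v\<close> at the point \<open>(3/4 - u, 3/4 - v)\<close>.\<close>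

definition h_poly :: "real \<Rightarrow> real \<Rightarrow> real" where
  "h_poly u v = 3 + 6 * (u\<^sup>2 - u * v + v\<^sup>2)"

text \<open>In each piece the first coordinate is the distinguished one. On fibres through \<open>piece1\<close> and
  \<open>piece2\<close> the mean of \<open>S\<close> is subtracted. For \<open>1 < x \<le> 5/4\<close>, \<open>F\<close> is \<open>- 32 (5/4 - x)\<close> where both other
  coordinates exceed \<open>5/4 - x\<close> (\<open>piece4\<close>), and on the adjacent strip (\<open>piece3\<close>) it is the centred
  \<open>g\<close> plus \<open>32 (1/4 - y)\<close>, which balances \<open>piece4\<close> on every fibre; the constant 32 is close to optimal.
  For \<open>x > 5/4\<close>, \<open>F\<close> vanishes.\<close>

definition piece_g :: "real \<times> real \<times> real \<Rightarrow> real" where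
  "piece_g = (\<lambda>(x, y, z). if 0 \<le> x \<and> 0 \<le> y \<and> 0 \<le> z \<and> y + z \<le> 3 / 4 \<and> x + y + z \<le> 3 / 2
     then g_poly y z else 0)"

definition piece1 :: "real \<times> real \<times> real \<Rightarrow> real" where
  "piece1 = (\<lambda>(x, y, z). if 0 \<le> x \<and> y \<le> 3 / 4 \<and> z \<le> 3 / 4 \<and> 5 / 4 < y + z \<and> x + y + z \<le> 3 / 2
     then h_poly (3 / 4 - y) (3 / 4 - z) else 0)"

definition piece2 :: "real \<times> real \<times> real \<Rightarrow> real" where
  "piece2 = (\<lambda>(x, y, z). if 3 / 4 < x \<and> 1 / 4 < y \<and> 0 \<le> z \<and> 5 / 4 < x + y \<and> x + y + z \<le> 3 / 2
     then g_mean y (3 / 2 - x - y) else 0)"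

definition piece3 :: "real \<times> real \<times> real \<Rightarrow> real" where
  "piece3 = (\<lambda>(x, y, z). if x \<le> 5 / 4 \<and> y \<le> 1 / 4 \<and> 0 \<le> z \<and> 5 / 4 < x + y \<and> x + z \<le> 5 / 4
     then g_mean y (5 / 4 - x) - 8 + 32 * y else 0)"

definition piece4 :: "real \<times> real \<times> real \<Rightarrow> real" where
  "piece4 = (\<lambda>(x, y, z). if x \<le> 5 / 4 \<and> 5 / 4 < x + y \<and> 5 / 4 < x + z \<and> x + y + z \<le> 3 / 2
     then g_poly y z + 40 - 32 * x else 0)"

definition piece5 :: "real \<times> real \<times> real \<Rightarrow> real" where
  "piece5 = (\<lambda>(x, y, z). if 5 / 4 < x \<and> 0 \<le> y \<and> 0 \<le> z \<and> x + y + z \<le> 3 / 2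
     then g_poly y z else 0)"

text \<open>The part of \<open>E\<close> whose distinguished coordinate is the first;
  \<open>E\<close> itself is \<open>cyc correction\<close>. The flipped copies of the two asymmetric
  pieces make it symmetric in the last two coordinates.\<close>

definition correction :: "real \<times> real \<times> real \<Rightarrow> real" where
  "correction t = piece1 t + piece2 t + piece2 (flip t) + piece3 t + piece3 (flip t) + piece4 t + piece5 t"

definition cyc :: "(real \<times> real \<times> real \<Rightarrow> real) \<Rightarrow> real \<times> real \<times> real \<Rightarrow> real" where
  "cyc f t = f t + f (rot t) + f (rot (rot t))"

definition F0 :: "real \<times> real \<times> real \<Rightarrow> real" where
  "F0 t = cyc piece_g t - cyc correction t"

lemmas piece_defs = piece_g_def piece1_def piece2_def piece3_def piece4_def piece5_def
lemmas poly_defs = g_poly_def g_mean_def h_poly_def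

section \<open>The function is piecewise polynomial\<close>

lemma open_or_closed_halfspaceI:
  "a \<noteq> 0 \<Longrightarrow> open_or_closed_halfspace {x. a \<bullet> x \<le> b}" "a \<noteq> 0 \<Longrightarrow> open_or_closed_halfspace {x. a \<bullet> x < b}"
  unfolding open_or_closed_halfspace_def by blast+

lemma polyhedral_cell_octant: "polyhedral_cell octant"
proof -
  have "octant = {t. (-1, 0, 0) \<bullet> t \<le> 0} \<inter> {t. (0, -1, 0) \<bullet> t \<le> 0} \<inter> {t. (0, 0, -1) \<bullet> t \<le> 0}"
    by (auto simp: octant_def)
  also have "polyhedral_cell \<dots>"
    by (intro polyhedral_cell_Int polyhedral_cell_halfspace open_or_closed_halfspaceI)
       (simp_all add: zero_prod_def)
  finally show ?thesis .
qed

text \<open>A constraint \<open>(s, a, b, c, d)\<close> stands for \<open>a x + b y + c z \<le> d\<close>, strict if \<open>s\<close> holds.\<close>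

definition satisfies :: "real \<times> real \<times> real \<Rightarrow> bool \<times> real \<times> real \<times> real \<times> real \<Rightarrow> bool" where
  "satisfies = (\<lambda>(x, y, z) (s, a, b, c, d).
     if s then a * x + b * y + c * z < d else a * x + b * y + c * z \<le> d)"

text \<open>Induction on the list adds one linear inequality at a time. Writing the conjunction as a
  list lets one lemma serve all six pieces.\<close>

lemma piecewise_polynomial_on_cell:
  assumes "real_polynomial_function p"
  shows "piecewise_polynomial_on octant (\<lambda>t. if \<forall>k\<in>set cs. satisfies t k then p t else 0)"
proof (induction cs)
  case Nil
  then show ?case using piecewise_polynomial_on_poly[OF polyhedral_cell_octant assms] by simp
next
  case (Cons k cs)
  obtain s a b c d where k: "k = (s, a, b, c, d)" by (metis surj_pair)
  define \<phi> where "\<phi> = (\<lambda>t :: real \<times> real \<times> real. a * fst t + b * fst (snd t) + c * snd (snd t))"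
  have "linear \<phi>" unfolding \<phi>_def by (intro linearI) (auto simp: algebra_simps)
  note pp = piecewise_polynomial_on_if_le[OF Cons this, of d]
  have sat: "satisfies t k \<longleftrightarrow> (if s then \<phi> t < d else \<phi> t \<le> d)" for t
    by (cases t) (simp add: satisfies_def k \<phi>_def)
  have eq: "(\<lambda>t. if \<forall>k\<in>set (k # cs). satisfies t k then p t else 0) =
    (\<lambda>t. if (if s then \<phi> t < d else \<phi> t \<le> d) then if \<forall>k\<in>set cs. satisfies t k then p t else 0 else 0)"
    by (rule ext) (simp add: sat)
  show ?case unfolding eq using pp by (cases s) simp_all
qed

lemma real_polynomial_coords:
  "real_polynomial_function (\<lambda>t :: real \<times> real \<times> real. fst t)"
  "real_polynomial_function (\<lambda>t :: real \<times> real \<times> real. fst (snd t))"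
  "real_polynomial_function (\<lambda>t :: real \<times> real \<times> real. snd (snd t))"
  by (intro real_polynomial_function.intros(1) bounded_linear_intros)+

lemmas polynomial_rules = real_polynomial_coords real_polynomial_function_diff
  real_polynomial_function_power real_polynomial_function.intros(2-4)

lemma piecewise_polynomial_pieces:
  "piecewise_polynomial_on octant piece_g" "piecewise_polynomial_on octant piece1"
  "piecewise_polynomial_on octant piece2" "piecewise_polynomial_on octant piece3"
  "piecewise_polynomial_on octant piece4" "piecewise_polynomial_on octant piece5"
proof -
  note cell = piecewise_polynomial_on_cell
  have poly: "real_polynomial_function (\<lambda>t :: real \<times> real \<times> real. g_poly (fst (snd t)) (snd (snd t)))"
    "real_polynomial_function (\<lambda>t :: real \<times> real \<times> real. h_poly (3 / 4 - fst (snd t)) (3 / 4 - snd (snd t)))"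
    "real_polynomial_function (\<lambda>t :: real \<times> real \<times> real. g_mean (fst (snd t)) (3 / 2 - fst t - fst (snd t)))"
    "real_polynomial_function (\<lambda>t :: real \<times> real \<times> real. g_mean (fst (snd t)) (5 / 4 - fst t) - 8 + 32 * fst (snd t))"
    "real_polynomial_function (\<lambda>t :: real \<times> real \<times> real. g_poly (fst (snd t)) (snd (snd t)) + 40 - 32 * fst t)"
    unfolding poly_defs by (intro polynomial_rules)+
  have "piece_g = (\<lambda>t. if \<forall>k\<in>set [(False, -1, 0, 0, 0), (False, 0, -1, 0, 0), (False, 0, 0, -1, 0),
      (False, 0, 1, 1, 3 / 4), (False, 1, 1, 1, 3 / 2)]. satisfies t k
      then g_poly (fst (snd t)) (snd (snd t)) else 0)"
    by (intro ext, simp only: piece_g_def split_beta, intro if_cong refl, auto simp: satisfies_def split_beta)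
  then show "piecewise_polynomial_on octant piece_g" by (rule ssubst) (rule cell[OF poly(1)])
  have "piece1 = (\<lambda>t. if \<forall>k\<in>set [(False, -1, 0, 0, 0), (False, 0, 1, 0, 3 / 4), (False, 0, 0, 1, 3 / 4),
      (True, 0, -1, -1, - 5 / 4), (False, 1, 1, 1, 3 / 2)]. satisfies t k
      then h_poly (3 / 4 - fst (snd t)) (3 / 4 - snd (snd t)) else 0)"
    by (intro ext, simp only: piece1_def split_beta, intro if_cong refl, auto simp: satisfies_def split_beta)
  then show "piecewise_polynomial_on octant piece1" by (rule ssubst) (rule cell[OF poly(2)])
  have "piece2 = (\<lambda>t. if \<forall>k\<in>set [(True, -1, 0, 0, - 3 / 4), (True, 0, -1, 0, - 1 / 4), (False, 0, 0, -1, 0),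
      (True, -1, -1, 0, - 5 / 4), (False, 1, 1, 1, 3 / 2)]. satisfies t k
      then g_mean (fst (snd t)) (3 / 2 - fst t - fst (snd t)) else 0)"
    by (intro ext, simp only: piece2_def split_beta, intro if_cong refl, auto simp: satisfies_def split_beta)
  then show "piecewise_polynomial_on octant piece2" by (rule ssubst) (rule cell[OF poly(3)])
  have "piece3 = (\<lambda>t. if \<forall>k\<in>set [(False, 1, 0, 0, 5 / 4), (False, 0, 1, 0, 1 / 4), (False, 0, 0, -1, 0),
      (True, -1, -1, 0, - 5 / 4), (False, 1, 0, 1, 5 / 4)]. satisfies t k
      then g_mean (fst (snd t)) (5 / 4 - fst t) - 8 + 32 * fst (snd t) else 0)"
    by (intro ext, simp only: piece3_def split_beta, intro if_cong refl, auto simp: satisfies_def split_beta)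
  then show "piecewise_polynomial_on octant piece3" by (rule ssubst) (rule cell[OF poly(4)])
  have "piece4 = (\<lambda>t. if \<forall>k\<in>set [(False, 1, 0, 0, 5 / 4), (True, -1, -1, 0, - 5 / 4),
      (True, -1, 0, -1, - 5 / 4), (False, 1, 1, 1, 3 / 2)]. satisfies t k
      then g_poly (fst (snd t)) (snd (snd t)) + 40 - 32 * fst t else 0)"
    by (intro ext, simp only: piece4_def split_beta, intro if_cong refl, auto simp: satisfies_def split_beta)
  then show "piecewise_polynomial_on octant piece4" by (rule ssubst) (rule cell[OF poly(5)])
  have "piece5 = (\<lambda>t. if \<forall>k\<in>set [(True, -1, 0, 0, - 5 / 4), (False, 0, -1, 0, 0), (False, 0, 0, -1, 0),
      (False, 1, 1, 1, 3 / 2)]. satisfies t k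
      then g_poly (fst (snd t)) (snd (snd t)) else 0)"
    by (intro ext, simp only: piece5_def split_beta, intro if_cong refl, auto simp: satisfies_def split_beta)
  then show "piecewise_polynomial_on octant piece5" by (rule ssubst) (rule cell[OF poly(1)])
qed

lemma piecewise_polynomial_permute:
  assumes "piecewise_polynomial_on octant f"
  shows "piecewise_polynomial_on octant (\<lambda>t. f (rot t))" "piecewise_polynomial_on octant (\<lambda>t. f (flip t))"
proof -
  have lin: "linear rot" "linear flip" by (intro linearI; simp add: rot_def flip_def)+
  have surj: "surj rot" "surj flip"
    by (rule surjI[of rot "\<lambda>t. rot (rot t)"], simp add: rot_def, rule surjI[of flip flip], simp add: flip_def)
  have oct: "rot -` octant = octant" "flip -` octant = octant"
    by (auto simp: octant_def rot_def flip_def)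
  show "piecewise_polynomial_on octant (\<lambda>t. f (rot t))" "piecewise_polynomial_on octant (\<lambda>t. f (flip t))"
    using piecewise_polynomial_on_linear_compose[OF assms] lin surj oct by blast+
qed

lemma piecewise_polynomial_F0: "piecewise_polynomial_on octant F0"
proof -
  have "piecewise_polynomial_on octant correction"
    unfolding correction_def[abs_def]
    by (intro piecewise_polynomial_on_add piecewise_polynomial_permute piecewise_polynomial_pieces)
  then show ?thesis
    unfolding F0_def[abs_def] cyc_def
    by (intro piecewise_polynomial_on_add piecewise_polynomial_on_diff
        piecewise_polynomial_pieces piecewise_polynomial_permute)
      (auto intro: piecewise_polynomial_permute[of correction]
        piecewise_polynomial_permute[of "\<lambda>t. correction (rot t)"]
        piecewise_polynomial_permute[of "\<lambda>t. piece_g (rot t)"] piecewise_polynomial_pieces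
        piecewise_polynomial_permute[of piece_g])
qed

section \<open>Boundedness, symmetry and support\<close>

lemma tame_pieces:
  "tame piece_g" "tame piece1" "tame piece2" "tame piece3" "tame piece4" "tame piece5"
proof -
  have [measurable]: "fst \<in> borel_measurable (borel :: (real \<times> real \<times> real) measure)"
    "snd \<in> borel_measurable (borel :: (real \<times> real \<times> real) measure)"
    "fst \<in> borel_measurable (borel :: (real \<times> real) measure)"
    "snd \<in> borel_measurable (borel :: (real \<times> real) measure)"
    by (intro borel_measurable_continuous_onI continuous_intros)+
  have *: "tame (\<lambda>t. if C t then p t else 0)"
    if "continuous_on UNIV p" "Measurable.pred borel C" "\<And>t. C t \<Longrightarrow> t \<in> cbox (0, 0, 0) (2, 2, 2)"
    for C :: "real \<times> real \<times> real \<Rightarrow> bool" and p using tame_if[OF that] .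
  show "tame piece_g" "tame piece1" "tame piece2" "tame piece3" "tame piece4" "tame piece5"
    unfolding piece_defs poly_defs case_prod_beta
    by (rule *, (intro continuous_intros; simp), measurable, (auto simp: cbox_Pair_eq)[1])+
qed

lemma tame_cyc: "tame f \<Longrightarrow> tame (cyc f)"
  unfolding cyc_def[abs_def]
  by (intro tame_add tame_permute(1) tame_permute(1)[of "\<lambda>t. f (rot t)"])

lemma tame_correction: "tame correction"
  unfolding correction_def[abs_def] by (intro tame_add tame_permute tame_pieces)

lemma tame_F0: "tame F0"
  unfolding F0_def[abs_def] by (intro tame_diff tame_cyc tame_pieces tame_correction)

lemma piece_apply:
  "piece_g (x, y, z) = (if 0 \<le> x \<and> 0 \<le> y \<and> 0 \<le> z \<and> y + z \<le> 3 / 4 \<and> x + y + z \<le> 3 / 2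
     then g_poly y z else 0)"
  "piece1 (x, y, z) = (if 0 \<le> x \<and> y \<le> 3 / 4 \<and> z \<le> 3 / 4 \<and> 5 / 4 < y + z \<and> x + y + z \<le> 3 / 2
     then h_poly (3 / 4 - y) (3 / 4 - z) else 0)"
  "piece2 (x, y, z) = (if 3 / 4 < x \<and> 1 / 4 < y \<and> 0 \<le> z \<and> 5 / 4 < x + y \<and> x + y + z \<le> 3 / 2
     then g_mean y (3 / 2 - x - y) else 0)"
  "piece3 (x, y, z) = (if x \<le> 5 / 4 \<and> y \<le> 1 / 4 \<and> 0 \<le> z \<and> 5 / 4 < x + y \<and> x + z \<le> 5 / 4
     then g_mean y (5 / 4 - x) - 8 + 32 * y else 0)"
  "piece4 (x, y, z) = (if x \<le> 5 / 4 \<and> 5 / 4 < x + y \<and> 5 / 4 < x + z \<and> x + y + z \<le> 3 / 2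
     then g_poly y z + 40 - 32 * x else 0)"
  "piece5 (x, y, z) = (if 5 / 4 < x \<and> 0 \<le> y \<and> 0 \<le> z \<and> x + y + z \<le> 3 / 2
     then g_poly y z else 0)"
  by (simp_all add: piece_defs)

lemma F0_apply:
  "F0 (x, y, z) = piece_g (x, y, z) + piece_g (y, z, x) + piece_g (z, x, y)
    - (piece1 (x, y, z) + piece2 (x, y, z) + piece2 (x, z, y) + piece3 (x, y, z) + piece3 (x, z, y)
       + piece4 (x, y, z) + piece5 (x, y, z))
    - (piece1 (y, z, x) + piece2 (y, z, x) + piece2 (y, x, z) + piece3 (y, z, x) + piece3 (y, x, z)
       + piece4 (y, z, x) + piece5 (y, z, x))
    - (piece1 (z, x, y) + piece2 (z, x, y) + piece2 (z, y, x) + piece3 (z, x, y) + piece3 (z, y, x)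
       + piece4 (z, x, y) + piece5 (z, x, y))"
  by (simp add: F0_def cyc_def correction_def)

lemma piece_sym:
  "piece_g (x, z, y) = piece_g (x, y, z)" "piece1 (x, z, y) = piece1 (x, y, z)"
  "piece4 (x, z, y) = piece4 (x, y, z)" "piece5 (x, z, y) = piece5 (x, y, z)"
  unfolding piece_apply by (simp_all add: poly_defs add_ac mult_ac conj_ac)

text \<open>A transposition reverses the cyclic order, so it permutes the cyclic summands up to an
  exchange of their last two arguments. \<open>piece2\<close> and \<open>piece3\<close> change under
  that exchange, but each occurs together with its flip.\<close>

lemma F0_swap: "F0 (y, x, z) = F0 (x, y, z)" and F0_rot: "F0 (y, z, x) = F0 (x, y, z)"
proof -
  show "F0 (y, z, x) = F0 (x, y, z)" by (simp add: F0_apply)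
  show "F0 (y, x, z) = F0 (x, y, z)"
    unfolding F0_apply
    using piece_sym[of x y z] piece_sym[of y z x] piece_sym[of z x y] by simp
qed

lemma symmetric_F0: "symmetric_on_octant F0"
  unfolding symmetric_on_octant_def using F0_swap F0_rot by metis

text \<open>Bounds that a piece does not list follow from those it does: in \<open>piece3\<close>,
  for instance, \<open>y \<le> 1 / 4\<close> and \<open>x + z \<le> 5 / 4\<close> give
  \<open>x + y + z \<le> 3 / 2\<close>.\<close>

lemma piece_support:
  assumes "f \<in> {piece_g, piece1, piece2, piece3, piece4, piece5}"
    and "x < 0 \<or> y < 0 \<or> z < 0 \<or> 3 / 2 < x + y + z"
  shows "f (x, y, z) = 0"
proof -
  from assms(1) consider "f = piece_g" | "f = piece1" | "f = piece2" | "f = piece3" | "f = piece4" | "f = piece5"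
    by blast
  then show ?thesis
  proof cases
    case 1 show ?thesis unfolding 1 piece_apply by (rule if_not_P) (use assms(2) in linarith) next
    case 2 show ?thesis unfolding 2 piece_apply by (rule if_not_P) (use assms(2) in linarith) next
    case 3 show ?thesis unfolding 3 piece_apply by (rule if_not_P) (use assms(2) in linarith) next
    case 4 show ?thesis unfolding 4 piece_apply by (rule if_not_P) (use assms(2) in linarith) next
    case 5 show ?thesis unfolding 5 piece_apply by (rule if_not_P) (use assms(2) in linarith) next
    case 6 show ?thesis unfolding 6 piece_apply by (rule if_not_P) (use assms(2) in linarith)
  qed
qed

lemma F0_support:
  assumes "x < 0 \<or> y < 0 \<or> z < 0 \<or> 3 / 2 < x + y + z"
  shows "F0 (x, y, z) = 0"
proof -
  have s: "f p = 0" if "f \<in> {piece_g, piece1, piece2, piece3, piece4, piece5}"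
    "p \<in> {(x, y, z), (x, z, y), (y, z, x), (y, x, z), (z, x, y), (z, y, x)}" for f p
    using that(2) assms piece_support[OF that(1)] by (auto simp: add_ac)
  show ?thesis unfolding F0_apply by (simp add: s)
qed

lemma closure_support_F0:
  "closure {t \<in> octant. F0 t \<noteq> 0} \<subseteq> {(t1, t2, t3) \<in> octant. t1 + t2 + t3 \<le> 3 / 2}"
proof (rule closure_minimal)
  show "{t \<in> octant. F0 t \<noteq> 0} \<subseteq> {(t1, t2, t3) \<in> octant. t1 + t2 + t3 \<le> 3 / 2}"
    using F0_support by (force simp: not_less[symmetric])
  have "{(t1, t2, t3) \<in> octant. t1 + t2 + t3 \<le> 3 / 2} =
    {t. 0 \<le> fst t \<and> 0 \<le> fst (snd t) \<and> 0 \<le> snd (snd t) \<and> fst t + fst (snd t) + snd (snd t) \<le> 3 / 2}"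
    by (auto simp: octant_def)
  also have "closed \<dots>" by (intro closed_Collect_conj closed_Collect_le continuous_intros)
  finally show "closed {(t1, t2, t3) \<in> octant. t1 + t2 + t3 \<le> 3 / 2}" .
qed

text \<open>Only \<open>S\<close> contributes: three times \<open>g_poly 0 0 = 12\<close>.\<close>

lemma F0_origin: "F0 (0, 0, 0) = 36"
  by (simp add: F0_apply piece_apply poly_defs)

subsection \<open>Vanishing marginals\<close>

text \<open>Here \<open>y\<close> exceeds 1/2, so within \<open>R\<close> the pair
  \<open>(x, y)\<close> is the only one with sum above 5/4. Both pairs containing \<open>z\<close>
  contribute a \<open>g\<close>, each on its own interval, and \<open>h_poly\<close> is their joint
  mean.\<close>

lemma F0_fiber1:
  assumes "y \<le> x" "x \<le> 3 / 4" "5 / 4 < x + y"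
  shows "F0 (x, y, z) = (if 0 \<le> z \<and> z \<le> 3 / 4 - x then g_poly x z else 0) + (if 0 \<le> z \<and> z \<le> 3 / 4 - y then g_poly y z else 0)
    - (if 0 \<le> z \<and> z \<le> 3 / 2 - x - y then h_poly (3 / 4 - x) (3 / 4 - y) else 0)"
proof -
  have zero: "piece1 (x, y, z) = 0"
    "piece2 (x, y, z) = 0"
    "piece2 (x, z, y) = 0"
    "piece3 (x, y, z) = 0"
    "piece3 (x, z, y) = 0"
    "piece4 (x, y, z) = 0"
    "piece5 (x, y, z) = 0"
    "piece1 (y, z, x) = 0"
    "piece2 (y, z, x) = 0"
    "piece2 (y, x, z) = 0"
    "piece3 (y, z, x) = 0"
    "piece3 (y, x, z) = 0"
    "piece4 (y, z, x) = 0"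
    "piece5 (y, z, x) = 0"
    "piece_g (z, x, y) = 0"
    "piece2 (z, x, y) = 0"
    "piece2 (z, y, x) = 0"
    "piece3 (z, x, y) = 0"
    "piece3 (z, y, x) = 0"
    "piece4 (z, x, y) = 0"
    "piece5 (z, x, y) = 0"
    unfolding piece_apply
    by (rule if_not_P; use assms in linarith)+
  have k0: "piece_g (x, y, z) = (if 0 \<le> z \<and> z \<le> 3 / 4 - y then g_poly y z else 0)"
    unfolding piece_apply by (rule if_cong) (use assms in \<open>auto simp: poly_defs algebra_simps\<close>)
  have k1: "piece_g (y, z, x) = (if 0 \<le> z \<and> z \<le> 3 / 4 - x then g_poly x z else 0)"
    unfolding piece_apply by (rule if_cong) (use assms in \<open>auto simp: poly_defs algebra_simps\<close>)
  have k2: "piece1 (z, x, y) = (if 0 \<le> z \<and> z \<le> 3 / 2 - x - y then h_poly (3 / 4 - x) (3 / 4 - y) else 0)"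
    unfolding piece_apply by (rule if_cong) (use assms in \<open>auto simp: poly_defs algebra_simps\<close>)
  show ?thesis unfolding F0_apply zero k0 k1 k2 by simp
qed
text \<open>\<open>1 / 4 < y\<close> keeps \<open>x + z\<close> below 5/4, so no other constrained
  fibre meets this one. As \<open>3 / 4 < x\<close>, only the pair \<open>(y, z)\<close> contributes
  to \<open>S\<close>, and it does so on the entire fibre.\<close>

lemma F0_fiber2:
  assumes "3 / 4 < x" "1 / 4 < y" "5 / 4 < x + y"
  shows "F0 (x, y, z) = (if 0 \<le> z \<and> z \<le> 3 / 2 - x - y then g_poly y z else 0)
    - (if 0 \<le> z \<and> z \<le> 3 / 2 - x - y then g_mean y (3 / 2 - x - y) else 0)"
proof -
  have zero: "piece1 (x, y, z) = 0"
    "piece2 (x, z, y) = 0"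
    "piece3 (x, y, z) = 0"
    "piece3 (x, z, y) = 0"
    "piece4 (x, y, z) = 0"
    "piece5 (x, y, z) = 0"
    "piece_g (y, z, x) = 0"
    "piece1 (y, z, x) = 0"
    "piece2 (y, z, x) = 0"
    "piece2 (y, x, z) = 0"
    "piece3 (y, z, x) = 0"
    "piece3 (y, x, z) = 0"
    "piece4 (y, z, x) = 0"
    "piece5 (y, z, x) = 0"
    "piece_g (z, x, y) = 0"
    "piece1 (z, x, y) = 0"
    "piece2 (z, x, y) = 0"
    "piece2 (z, y, x) = 0"
    "piece3 (z, x, y) = 0"
    "piece3 (z, y, x) = 0"
    "piece4 (z, x, y) = 0"
    "piece5 (z, x, y) = 0"
    unfolding piece_apply
    by (rule if_not_P; use assms in linarith)+
  have k0: "piece_g (x, y, z) = (if 0 \<le> z \<and> z \<le> 3 / 2 - x - y then g_poly y z else 0)"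
    unfolding piece_apply by (rule if_cong) (use assms in \<open>auto simp: poly_defs algebra_simps\<close>)
  have k1: "piece2 (x, y, z) = (if 0 \<le> z \<and> z \<le> 3 / 2 - x - y then g_mean y (3 / 2 - x - y) else 0)"
    unfolding piece_apply by (rule if_cong) (use assms in \<open>auto simp: poly_defs algebra_simps\<close>)
  show ?thesis unfolding F0_apply zero k0 k1 by simp
qed
text \<open>The fibre splits at \<open>z = 5 / 4 - x\<close>: beyond this point \<open>x + z\<close>
  exceeds 5/4 as well and a second marginal condition applies.\<close>

lemma F0_fiber3:
  assumes "x \<le> 5 / 4" "y \<le> 1 / 4" "0 \<le> y" "5 / 4 < x + y"
  shows "F0 (x, y, z) = (if 0 \<le> z \<and> z \<le> 3 / 2 - x - y then g_poly y z else 0)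
    - (if 0 \<le> z \<and> z \<le> 5 / 4 - x then g_mean y (5 / 4 - x) - 8 + 32 * y else 0)
    - (if 5 / 4 - x < z \<and> z \<le> 3 / 2 - x - y then g_poly y z + 40 - 32 * x else 0)"
proof -
  have zero: "piece1 (x, y, z) = 0"
    "piece2 (x, y, z) = 0"
    "piece2 (x, z, y) = 0"
    "piece3 (x, z, y) = 0"
    "piece5 (x, y, z) = 0"
    "piece_g (y, z, x) = 0"
    "piece1 (y, z, x) = 0"
    "piece2 (y, z, x) = 0"
    "piece2 (y, x, z) = 0"
    "piece3 (y, z, x) = 0"
    "piece3 (y, x, z) = 0"
    "piece4 (y, z, x) = 0"
    "piece5 (y, z, x) = 0"
    "piece_g (z, x, y) = 0"
    "piece1 (z, x, y) = 0"
    "piece2 (z, x, y) = 0"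
    "piece2 (z, y, x) = 0"
    "piece3 (z, x, y) = 0"
    "piece3 (z, y, x) = 0"
    "piece4 (z, x, y) = 0"
    "piece5 (z, x, y) = 0"
    unfolding piece_apply
    by (rule if_not_P; use assms in linarith)+
  have k0: "piece_g (x, y, z) = (if 0 \<le> z \<and> z \<le> 3 / 2 - x - y then g_poly y z else 0)"
    unfolding piece_apply by (rule if_cong) (use assms in \<open>auto simp: poly_defs algebra_simps\<close>)
  have k1: "piece3 (x, y, z) = (if 0 \<le> z \<and> z \<le> 5 / 4 - x then g_mean y (5 / 4 - x) - 8 + 32 * y else 0)"
    unfolding piece_apply by (rule if_cong) (use assms in \<open>auto simp: poly_defs algebra_simps\<close>)
  have k2: "piece4 (x, y, z) = (if 5 / 4 - x < z \<and> z \<le> 3 / 2 - x - y then g_poly y z + 40 - 32 * x else 0)"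
    unfolding piece_apply by (rule if_cong) (use assms in \<open>auto simp: poly_defs algebra_simps\<close>)
  show ?thesis unfolding F0_apply zero k0 k1 k2 by simp
qed
text \<open>\<open>correction\<close> equals \<open>S\<close> here, the simplest way to meet both
  marginal conditions at once.\<close>

lemma F0_fiber4:
  assumes "5 / 4 < x" "0 \<le> y"
  shows "F0 (x, y, z) = 0"
proof -
  have zero: "piece1 (x, y, z) = 0"
    "piece2 (x, y, z) = 0"
    "piece2 (x, z, y) = 0"
    "piece3 (x, y, z) = 0"
    "piece3 (x, z, y) = 0"
    "piece4 (x, y, z) = 0"
    "piece_g (y, z, x) = 0"
    "piece1 (y, z, x) = 0"
    "piece2 (y, z, x) = 0"
    "piece2 (y, x, z) = 0"
    "piece3 (y, z, x) = 0"
    "piece3 (y, x, z) = 0"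
    "piece4 (y, z, x) = 0"
    "piece5 (y, z, x) = 0"
    "piece_g (z, x, y) = 0"
    "piece1 (z, x, y) = 0"
    "piece2 (z, x, y) = 0"
    "piece2 (z, y, x) = 0"
    "piece3 (z, x, y) = 0"
    "piece3 (z, y, x) = 0"
    "piece4 (z, x, y) = 0"
    "piece5 (z, x, y) = 0"
    unfolding piece_apply
    by (rule if_not_P; use assms in linarith)+
  have k0: "piece_g (x, y, z) = (if 0 \<le> z \<and> z \<le> 3 / 2 - x - y then g_poly y z else 0)"
    unfolding piece_apply by (rule if_cong) (use assms in \<open>auto simp: poly_defs algebra_simps\<close>)
  have k1: "piece5 (x, y, z) = (if 0 \<le> z \<and> z \<le> 3 / 2 - x - y then g_poly y z else 0)"
    unfolding piece_apply by (rule if_cong) (use assms in \<open>auto simp: poly_defs algebra_simps\<close>)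
  show ?thesis unfolding F0_apply zero k0 k1 by simp
qed

lemma marginal_F0:
  assumes "0 \<le> y" "5 / 4 < x + y" "y \<le> x"
  shows "(LINT z|lborel. F0 (x, y, z)) = 0"
proof -
  note prim = has_bochner_integral_antiderivative
  have hb: "has_bochner_integral lborel (\<lambda>z. if 0 \<le> z \<and> z \<le> b then f z else 0) (\<Phi> b - \<Phi> 0)"
    "has_bochner_integral lborel (\<lambda>z. if a < z \<and> z \<le> b then f z else 0) (\<Phi> b - \<Phi> a)"
    if "0 \<le> b" "a \<le> b" "\<And>z. (\<Phi> has_real_derivative f z) (at z)" "continuous_on UNIV f" for a b f \<Phi>
  proof -
    have [measurable]: "f \<in> borel_measurable borel" using that(4) by (rule borel_measurable_continuous_onI)
    show "has_bochner_integral lborel (\<lambda>z. if 0 \<le> z \<and> z \<le> b then f z else 0) (\<Phi> b - \<Phi> 0)"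
      by (rule prim[OF that(1,3,4)]) auto
    show "has_bochner_integral lborel (\<lambda>z. if a < z \<and> z \<le> b then f z else 0) (\<Phi> b - \<Phi> a)"
      by (rule prim[OF that(2,3,4)]) auto
  qed
  \<comment> \<open>The antiderivative of \<open>g_poly w\<close> that vanishes at 0, so
    \<open>g_mean\<close> is its quotient by the length.\<close>
  define G where "G w z = (12 - 21 * w + 12 * w\<^sup>2) * z + (10 * w - 21 / 2) * z\<^sup>2 + 4 * z ^ 3" for w z :: real
  have G: "(G w has_real_derivative g_poly w z) (at z)" for w z
    unfolding G_def g_poly_def
    by (rule derivative_eq_intros refl | simp)+ (simp add: algebra_simps power2_eq_square)
  have G0: "G w 0 = 0" for w by (simp add: G_def)
  have Gl: "G w l = l * g_mean w l" for w l
    by (simp add: G_def g_mean_def algebra_simps power2_eq_square power3_eq_cube)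
  have cont: "continuous_on UNIV (g_poly w)" for w
    unfolding g_poly_def by (intro continuous_intros)
  have const: "((\<lambda>z. c * z) has_real_derivative c) (at z)" for c z :: real
    by (rule derivative_eq_intros refl | simp)+
  note hbG = hb(1)[OF _ order_refl G cont] and hbc = hb(1)[OF _ order_refl const continuous_on_const]
  have "has_bochner_integral lborel (\<lambda>z. F0 (x, y, z)) 0"
  proof -
    consider "x \<le> 3 / 4" | "3 / 2 < x + y" "3 / 4 < x" | "x + y \<le> 3 / 2" "3 / 4 < x" "1 / 4 < y"
      | "y \<le> 1 / 4" "x \<le> 5 / 4" "3 / 4 < x" | "5 / 4 < x" by linarith
    then show ?thesis
    proof cases
      case 1
      have "has_bochner_integral lborel (\<lambda>z. F0 (x, y, z))
         (G x (3 / 4 - x) - G x 0 + (G y (3 / 4 - y) - G y 0)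
           - (h_poly (3 / 4 - x) (3 / 4 - y) * (3 / 2 - x - y) - h_poly (3 / 4 - x) (3 / 4 - y) * 0))"
        unfolding F0_fiber1[OF \<open>y \<le> x\<close> 1 \<open>5 / 4 < x + y\<close>]
        by (intro has_bochner_integral_diff has_bochner_integral_add hbG hbc) (use assms 1 in auto)
      \<comment> \<open>With u = 3/4 - x and v = 3/4 - y the two integrals are 3 u + 6 u^3 and 3 v +
        6 v^3; their sum is (u + v) times \<open>h_poly u v\<close>.\<close>
      also have "G x (3 / 4 - x) - G x 0 + (G y (3 / 4 - y) - G y 0)
           - (h_poly (3 / 4 - x) (3 / 4 - y) * (3 / 2 - x - y) - h_poly (3 / 4 - x) (3 / 4 - y) * 0) = 0"
        unfolding Gl G0 g_mean_def h_poly_def by (simp add: field_simps power2_eq_square)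
      finally show ?thesis .
    next
      case 2
      then have "F0 (x, y, z) = 0" for z using F0_support[of x y z] by linarith
      then show ?thesis by (simp add: has_bochner_integral_zero)
    next
      case 3
      have "has_bochner_integral lborel (\<lambda>z. F0 (x, y, z))
         (G y (3 / 2 - x - y) - G y 0
           - (g_mean y (3 / 2 - x - y) * (3 / 2 - x - y) - g_mean y (3 / 2 - x - y) * 0))"
        unfolding F0_fiber2[OF 3(2,3) \<open>5 / 4 < x + y\<close>]
        by (intro has_bochner_integral_diff hbG hbc) (use assms 3 in auto)
      then show ?thesis by (simp add: Gl G0)
    next
      case 4
      let ?m = "g_mean y (5 / 4 - x) - 8 + 32 * y"
      define K where "K z = G y z + (40 - 32 * x) * z" for z
      have K: "(K has_real_derivative g_poly y z + 40 - 32 * x) (at z)" for z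
        unfolding K_def by (rule derivative_eq_intros G refl | simp)+
      have contK: "continuous_on UNIV (\<lambda>z. g_poly y z + 40 - 32 * x)"
        by (intro continuous_intros cont)
      have "has_bochner_integral lborel (\<lambda>z. F0 (x, y, z))
         (G y (3 / 2 - x - y) - G y 0 - (?m * (5 / 4 - x) - ?m * 0) - (K (3 / 2 - x - y) - K (5 / 4 - x)))"
        unfolding F0_fiber3[OF 4(2,1) \<open>0 \<le> y\<close> \<open>5 / 4 < x + y\<close>]
        by (intro has_bochner_integral_diff hbG hbc hb(2)[OF _ _ K contK]) (use assms 4 in auto)
      \<comment> \<open>The contributions of \<open>g\<close> cancel. What is left on the two parts
        of the fibre is 32 (1/4 - y) (5/4 - x) with opposite signs.\<close>
      also have "G y (3 / 2 - x - y) - G y 0 - (?m * (5 / 4 - x) - ?m * 0) - (K (3 / 2 - x - y) - K (5 / 4 - x)) = 0"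
        by (simp add: Gl G0 K_def algebra_simps)
      finally show ?thesis .
    next
      case 5
      show ?thesis by (simp add: F0_fiber4[OF 5 \<open>0 \<le> y\<close>] has_bochner_integral_zero)
    qed
  qed
  then show ?thesis by (rule has_bochner_integral_integral_eq)
qed

subsection \<open>Integrals of the pieces\<close>

lemma g_poly_commute: "g_poly y z = g_poly z y"
  by (simp add: g_poly_def algebra_simps)

text \<open>Iterated integration with explicit antiderivatives: \<open>P\<close> in z,
  \<open>Q\<close> in y, \<open>R\<close> in x. Values on the boundary of the region do not affect
  the integral, so \<open>val\<close> asks only for the interior. The cut-off to a slab in x allows
  for regions whose bounds change their formula along the way.\<close>

lemma slab_integral:
  fixes f :: "real \<times> real \<times> real \<Rightarrow> real"
  assumes "tame f"
    and supp: "\<And>x y z. a < x \<Longrightarrow> x < b \<Longrightarrow> f (x, y, z) \<noteq> 0 \<Longrightarrow>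
      l x \<le> y \<and> y \<le> u x \<and> m x y \<le> z \<and> z \<le> n x y"
    and val: "\<And>x y z. a < x \<Longrightarrow> x < b \<Longrightarrow> l x < y \<Longrightarrow> y < u x \<Longrightarrow> m x y < z \<Longrightarrow> z < n x y \<Longrightarrow>
      f (x, y, z) = p x y z"
    and ord: "a \<le> b" "\<And>x. a < x \<Longrightarrow> x < b \<Longrightarrow> l x \<le> u x"
      "\<And>x y. a < x \<Longrightarrow> x < b \<Longrightarrow> l x < y \<Longrightarrow> y < u x \<Longrightarrow> m x y \<le> n x y"
    and P: "\<And>x y z. (P x y has_real_derivative p x y z) (at z)" "\<And>x y. continuous_on UNIV (p x y)"
    and Q: "\<And>x y. (Q x has_real_derivative P x y (n x y) - P x y (m x y)) (at y)"
      "\<And>x. continuous_on UNIV (\<lambda>y. P x y (n x y) - P x y (m x y))"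
    and R: "\<And>x. (R has_real_derivative Q x (u x) - Q x (l x)) (at x)"
      "continuous_on UNIV (\<lambda>x. Q x (u x) - Q x (l x))"
  shows "(LINT x|lborel. indicator {a..b} x * (LINT y|lborel. LINT z|lborel. f (x, y, z))) = R b - R a"
proof -
  have inner: "(LINT z|lborel. f (x, y, z)) = P x y (n x y) - P x y (m x y)"
    if "a < x" "x < b" "l x < y" "y < u x" for x y
  proof (rule lborel_integral_antiderivative[OF ord(3)[OF that] P tame_measurable[OF tame_section2[OF assms(1)]]])
    show "f (x, y, z) = 0" if "z < m x y \<or> n x y < z" for z
      using supp[OF \<open>a < x\<close> \<open>x < b\<close>, of y z] that by force
  qed (rule val[OF that])
  have outside: "(LINT z|lborel. f (x, y, z)) = 0"
    if "a < x" "x < b" "y < l x \<or> u x < y" for x y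
  proof -
    have "f (x, y, z) = 0" for z using supp[of x y z] that by force
    then show ?thesis by simp
  qed
  have middle: "(LINT y|lborel. LINT z|lborel. f (x, y, z)) = Q x (u x) - Q x (l x)"
    if "a < x" "x < b" for x
    by (rule lborel_integral_antiderivative[OF ord(2)[OF that] Q
          tame_measurable[OF tame_marginal[OF tame_section[OF assms(1)]]]])
       (use that inner outside in auto)
  have "tame (\<lambda>x. LINT t|lborel. f (x, t))" by (rule tame_marginal[OF assms(1)])
  then have "tame (\<lambda>x. LINT y|lborel. LINT z|lborel. f (x, y, z))"
    using tame_Fubini(1)[OF tame_section[OF assms(1)]] by simp
  then have "(\<lambda>x. LINT y|lborel. LINT z|lborel. f (x, y, z)) \<in> borel_measurable borel"
    by (rule tame_measurable)
  then have meas: "(\<lambda>x. indicator {a..b} x * (LINT y|lborel. LINT z|lborel. f (x, y, z))) \<in> borel_measurable borel"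
    by (intro borel_measurable_times borel_measurable_indicator) auto
  show ?thesis
    by (rule lborel_integral_antiderivative[OF ord(1) R meas]) (use middle in auto)
qed

lemma region_integral:
  fixes f :: "real \<times> real \<times> real \<Rightarrow> real"
  assumes "tame f"
    and supp: "\<And>x y z. f (x, y, z) \<noteq> 0 \<Longrightarrow>
      a \<le> x \<and> x \<le> b \<and> l x \<le> y \<and> y \<le> u x \<and> m x y \<le> z \<and> z \<le> n x y"
    and val: "\<And>x y z. a < x \<Longrightarrow> x < b \<Longrightarrow> l x < y \<Longrightarrow> y < u x \<Longrightarrow> m x y < z \<Longrightarrow> z < n x y \<Longrightarrow>
      f (x, y, z) = p x y z"
    and ord: "a \<le> b" "\<And>x. a < x \<Longrightarrow> x < b \<Longrightarrow> l x \<le> u x"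
      "\<And>x y. a < x \<Longrightarrow> x < b \<Longrightarrow> l x < y \<Longrightarrow> y < u x \<Longrightarrow> m x y \<le> n x y"
    and P: "\<And>x y z. (P x y has_real_derivative p x y z) (at z)" "\<And>x y. continuous_on UNIV (p x y)"
    and Q: "\<And>x y. (Q x has_real_derivative P x y (n x y) - P x y (m x y)) (at y)"
      "\<And>x. continuous_on UNIV (\<lambda>y. P x y (n x y) - P x y (m x y))"
    and R: "\<And>x. (R has_real_derivative Q x (u x) - Q x (l x)) (at x)"
      "continuous_on UNIV (\<lambda>x. Q x (u x) - Q x (l x))"
  shows "(LINT t|lborel. f t) = R b - R a"
proof -
  have "(LINT t|lborel. f t) = (LINT x|lborel. indicator {a..b} x * (LINT y|lborel. LINT z|lborel. f (x, y, z)))"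
    unfolding tame_Fubini3[OF assms(1)]
  proof (rule Bochner_Integration.integral_cong[OF refl])
    fix x
    show "(LINT y|lborel. LINT z|lborel. f (x, y, z)) =
      indicator {a..b} x * (LINT y|lborel. LINT z|lborel. f (x, y, z))"
    proof (cases "x \<in> {a..b}")
      case False
      then have "f (x, y, z) = 0" for y z using supp[of x y z] by auto
      then show ?thesis by simp
    qed simp
  qed
  also have "\<dots> = R b - R a"
    by (rule slab_integral[OF assms(1) _ val ord P Q R]) (use supp in auto)
  finally show ?thesis .
qed

text \<open>After two rotations the free coordinate comes last and is integrated first, from 0 to
  3/2 - x - y. \<open>P\<close>, \<open>Q\<close> and \<open>R\<close> are successive
  antiderivatives that vanish at 0, so every check is a polynomial identity.\<close>

lemma integral_sq_piece_g: "(LINT t|lborel. (piece_g (rot (rot t)))\<^sup>2) = 297999 / 35840"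
proof -
  define P where "P x y z = 144 * z - 504 * x * z - 504 * y * z + 729 * x ^ 2 * z + 1362 * x * y * z
      + 729 * y ^ 2 * z - 504 * x ^ 3 * z - 1344 * x ^ 2 * y * z - 1344 * x * y ^ 2 * z
      - 504 * y ^ 3 * z + 144 * x ^ 4 * z + 480 * x ^ 3 * y * z + 688 * x ^ 2 * y ^ 2 * z
      + 480 * x * y ^ 3 * z + 144 * y ^ 4 * z" for x y z :: real
  define Q where "Q x y = 216 * y - 900 * x * y - 450 * y ^ 2 + 3195 / 2 * x ^ 2 * y + 3051 / 2 * x * y ^ 2
      + 1065 / 2 * y ^ 3 - 1485 * x ^ 3 * y - 4107 / 2 * x ^ 2 * y ^ 2 - 1369 * x * y ^ 3
      - 1485 / 4 * y ^ 4 + 720 * x ^ 4 * y + 1284 * x ^ 3 * y ^ 2 + 1240 * x ^ 2 * y ^ 3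
      + 642 * x * y ^ 4 + 144 * y ^ 5 - 144 * x ^ 5 * y - 312 * x ^ 4 * y ^ 2
      - 1168 / 3 * x ^ 3 * y ^ 3 - 292 * x ^ 2 * y ^ 4 - 624 / 5 * x * y ^ 5 - 24 * y ^ 6" for x y :: real
  define R where "R x = 47061 / 1024 * x - 145719 / 1280 * x ^ 2 + 10635 / 64 * x ^ 3 - 1227 / 8 * x ^ 4
      + 1771 / 20 * x ^ 5 - 89 / 3 * x ^ 6 + 452 / 105 * x ^ 7" for x :: real
  have "(LINT t|lborel. (piece_g (rot (rot t)))\<^sup>2) = R (3 / 4) - R (0)"
  proof (rule region_integral[where p = "\<lambda>x y z. (g_poly x y)\<^sup>2" and P = P and Q = Q and R = R
        and l = "\<lambda>x. 0" and u = "\<lambda>x. 3 / 4 - x" and m = "\<lambda>x y. 0" and n = "\<lambda>x y. 3 / 2 - x - y"])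
    show "tame (\<lambda>t. (piece_g (rot (rot t)))\<^sup>2)"
      by (intro tame_power2 tame_permute(1)[OF tame_permute(1)[OF tame_pieces(1)]])
    show "(P x y has_real_derivative (g_poly x y)\<^sup>2) (at z)" for x y z
      unfolding P_def by (rule derivative_eq_intros refl | simp)+ (simp add: poly_defs field_simps eval_nat_numeral)
    show "(Q x has_real_derivative P x y (3 / 2 - x - y) - P x y (0)) (at y)" for x y
      unfolding P_def Q_def by (rule derivative_eq_intros refl | simp)+ (simp add: poly_defs field_simps eval_nat_numeral)
    show "(R has_real_derivative Q x (3 / 4 - x) - Q x (0)) (at x)" for x
      unfolding Q_def R_def by (rule derivative_eq_intros refl | simp)+ (simp add: poly_defs field_simps eval_nat_numeral)
    show "continuous_on UNIV (\<lambda>z. (g_poly x y)\<^sup>2)" for x y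
      unfolding poly_defs by (intro continuous_intros)
    show "continuous_on UNIV (\<lambda>y. P x y (3 / 2 - x - y) - P x y (0))" for x
      unfolding P_def by (intro continuous_intros)
    show "continuous_on UNIV (\<lambda>x. Q x (3 / 4 - x) - Q x (0))"
      unfolding Q_def by (intro continuous_intros)
  qed (auto simp: piece_apply split: if_splits)
  also have "\<dots> = 297999 / 35840" by (simp add: R_def eval_nat_numeral)
  finally show ?thesis .
qed

text \<open>The two factors share only the coordinate \<open>x\<close>. For fixed \<open>x\<close>
  the domain is a square of side 3/4 - x, which lies in \<open>R\<close> automatically since the
  total is at most 3/2 - x.\<close>

lemma integral_cross_piece_g: "(LINT t|lborel. piece_g (rot t) * piece_g (rot (rot t))) = 524799 / 143360"
proof -
  define P where "P x y z = 144 * z - 504 * x * z - 252 * y * z - 126 * z ^ 2 + 729 * x ^ 2 * z + 681 * x * y * z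
      + 681 / 2 * x * z ^ 2 + 144 * y ^ 2 * z + 441 / 2 * y * z ^ 2 + 48 * z ^ 3
      - 504 * x ^ 3 * z - 672 * x ^ 2 * y * z - 336 * x ^ 2 * z ^ 2 - 252 * x * y ^ 2 * z
      - 420 * x * y * z ^ 2 - 84 * x * z ^ 3 - 126 * y ^ 2 * z ^ 2 - 84 * y * z ^ 3
      + 144 * x ^ 4 * z + 240 * x ^ 3 * y * z + 120 * x ^ 3 * z ^ 2 + 144 * x ^ 2 * y ^ 2 * z
      + 200 * x ^ 2 * y * z ^ 2 + 48 * x ^ 2 * z ^ 3 + 120 * x * y ^ 2 * z ^ 2
      + 80 * x * y * z ^ 3 + 48 * y ^ 2 * z ^ 3" for x y z :: real
  define Q where "Q x y = 459 / 8 * y - 8253 / 32 * x * y - 3213 / 64 * y ^ 2 + 495 * x ^ 2 * y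
      + 1485 / 8 * x * y ^ 2 + 153 / 8 * y ^ 3 - 513 * x ^ 3 * y - 273 * x ^ 2 * y ^ 2
      - 105 / 2 * x * y ^ 3 + 288 * x ^ 4 * y + 198 * x ^ 3 * y ^ 2 + 54 * x ^ 2 * y ^ 3
      - 72 * x ^ 5 * y - 60 * x ^ 4 * y ^ 2 - 24 * x ^ 3 * y ^ 3" for x y :: real
  define R where "R x = 23409 / 1024 * x - 16065 / 256 * x ^ 2 + 6429 / 64 * x ^ 3 - 1647 / 16 * x ^ 4
      + 1359 / 20 * x ^ 5 - 27 * x ^ 6 + 36 / 7 * x ^ 7" for x :: real
  have "(LINT t|lborel. piece_g (rot t) * piece_g (rot (rot t))) = R (3 / 4) - R (0)"
  proof (rule region_integral[where p = "\<lambda>x y z. g_poly x y * g_poly x z" and P = P and Q = Q and R = R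
        and l = "\<lambda>x. 0" and u = "\<lambda>x. 3 / 4 - x" and m = "\<lambda>x y. 0" and n = "\<lambda>x y. 3 / 4 - x"])
    show "tame (\<lambda>t. piece_g (rot t) * piece_g (rot (rot t)))"
      by (intro tame_mult tame_permute(1)[OF tame_permute(1)[OF tame_pieces(1)]] tame_permute(1) tame_pieces)
    show "(P x y has_real_derivative g_poly x y * g_poly x z) (at z)" for x y z
      unfolding P_def by (rule derivative_eq_intros refl | simp)+ (simp add: poly_defs field_simps eval_nat_numeral)
    show "(Q x has_real_derivative P x y (3 / 4 - x) - P x y (0)) (at y)" for x y
      unfolding P_def Q_def by (rule derivative_eq_intros refl | simp)+ (simp add: poly_defs field_simps eval_nat_numeral)
    show "(R has_real_derivative Q x (3 / 4 - x) - Q x (0)) (at x)" for x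
      unfolding Q_def R_def by (rule derivative_eq_intros refl | simp)+ (simp add: poly_defs field_simps eval_nat_numeral)
    show "continuous_on UNIV (\<lambda>z. g_poly x y * g_poly x z)" for x y
      unfolding poly_defs by (intro continuous_intros)
    show "continuous_on UNIV (\<lambda>y. P x y (3 / 4 - x) - P x y (0))" for x
      unfolding P_def by (intro continuous_intros)
    show "continuous_on UNIV (\<lambda>x. Q x (3 / 4 - x) - Q x (0))"
      unfolding Q_def by (intro continuous_intros)
  qed (auto simp: piece_apply g_poly_commute split: if_splits)
  also have "\<dots> = 524799 / 143360" by (simp add: R_def eval_nat_numeral)
  finally show ?thesis .
qed

lemma integral_sq_piece1: "(LINT t|lborel. (piece1 (rot (rot t)))\<^sup>2) = 2895 / 57344"
proof -
  define P where "P x y z = 2601 / 64 * z - 459 / 8 * x * z - 459 / 8 * y * z + 387 / 4 * x ^ 2 * z - 36 * x * y * z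
      + 387 / 4 * y ^ 2 * z - 54 * x ^ 3 * z - 54 * y ^ 3 * z + 36 * x ^ 4 * z
      - 72 * x ^ 3 * y * z + 108 * x ^ 2 * y ^ 2 * z - 72 * x * y ^ 3 * z + 36 * y ^ 4 * z" for x y z :: real
  define Q where "Q x y = 7803 / 128 * y - 8109 / 64 * x * y - 8109 / 128 * y ^ 2 + 405 / 2 * x ^ 2 * y
      + 243 / 8 * x * y ^ 2 + 135 / 2 * y ^ 3 - 711 / 4 * x ^ 3 * y - 243 / 8 * x ^ 2 * y ^ 2
      - 81 / 4 * x * y ^ 3 - 711 / 16 * y ^ 4 + 108 * x ^ 4 * y - 27 * x ^ 3 * y ^ 2
      + 54 * x ^ 2 * y ^ 3 - 27 / 2 * x * y ^ 4 + 108 / 5 * y ^ 5 - 36 * x ^ 5 * y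
      + 18 * x ^ 4 * y ^ 2 - 12 * x ^ 3 * y ^ 3 - 9 * x ^ 2 * y ^ 4 + 36 / 5 * x * y ^ 5
      - 6 * y ^ 6" for x y :: real
  define R where "R x = - 19239 / 1280 * x + 125487 / 2560 * x ^ 2 - 11649 / 128 * x ^ 3 + 6777 / 64 * x ^ 4
      - 6183 / 80 * x ^ 5 + 657 / 20 * x ^ 6 - 219 / 35 * x ^ 7" for x :: real
  have "(LINT t|lborel. (piece1 (rot (rot t)))\<^sup>2) = R (3 / 4) - R (1 / 2)"
  proof (rule region_integral[where p = "\<lambda>x y z. (h_poly (3 / 4 - x) (3 / 4 - y))\<^sup>2" and P = P and Q = Q and R = R
        and l = "\<lambda>x. 5 / 4 - x" and u = "\<lambda>x. 3 / 4" and m = "\<lambda>x y. 0" and n = "\<lambda>x y. 3 / 2 - x - y"])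
    show "tame (\<lambda>t. (piece1 (rot (rot t)))\<^sup>2)"
      by (intro tame_power2 tame_permute(1)[OF tame_permute(1)[OF tame_pieces(2)]])
    show "(P x y has_real_derivative (h_poly (3 / 4 - x) (3 / 4 - y))\<^sup>2) (at z)" for x y z
      unfolding P_def by (rule derivative_eq_intros refl | simp)+ (simp add: poly_defs field_simps eval_nat_numeral)
    show "(Q x has_real_derivative P x y (3 / 2 - x - y) - P x y (0)) (at y)" for x y
      unfolding P_def Q_def by (rule derivative_eq_intros refl | simp)+ (simp add: poly_defs field_simps eval_nat_numeral)
    show "(R has_real_derivative Q x (3 / 4) - Q x (5 / 4 - x)) (at x)" for x
      unfolding Q_def R_def by (rule derivative_eq_intros refl | simp)+ (simp add: poly_defs field_simps eval_nat_numeral)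
    show "continuous_on UNIV (\<lambda>z. (h_poly (3 / 4 - x) (3 / 4 - y))\<^sup>2)" for x y
      unfolding poly_defs by (intro continuous_intros)
    show "continuous_on UNIV (\<lambda>y. P x y (3 / 2 - x - y) - P x y (0))" for x
      unfolding P_def by (intro continuous_intros)
    show "continuous_on UNIV (\<lambda>x. Q x (3 / 4) - Q x (5 / 4 - x))"
      unfolding Q_def by (intro continuous_intros)
  qed (auto simp: piece_apply split: if_splits)
  also have "\<dots> = 2895 / 57344" by (simp add: R_def eval_nat_numeral)
  finally show ?thesis .
qed

lemma integral_sq_piece3: "(LINT t|lborel. (piece3 t)\<^sup>2) = 415591 / 5160960"
proof -
  define P where "P x y z = 529 / 64 * z - 23 / 8 * x * z - 1081 / 8 * y * z - 91 / 4 * x ^ 2 * z + 81 * x * y * z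
      + 1933 / 4 * y ^ 2 * z + 4 * x ^ 3 * z + 178 * x ^ 2 * y * z - 458 * x * y ^ 2 * z
      + 564 * y ^ 3 * z + 16 * x ^ 4 * z - 80 * x ^ 3 * y * z + 196 * x ^ 2 * y ^ 2 * z
      - 240 * x * y ^ 3 * z + 144 * y ^ 4 * z" for x y z :: real
  define Q where "Q x y = 2645 / 256 * y - 759 / 64 * x * y - 5405 / 64 * y ^ 2 - 409 / 16 * x ^ 2 * y
      + 1891 / 16 * x * y ^ 2 + 9665 / 48 * y ^ 3 + 111 / 4 * x ^ 3 * y
      + 283 / 4 * x ^ 2 * y ^ 2 - 4223 / 12 * x * y ^ 3 + 705 / 4 * y ^ 4 + 16 * x ^ 4 * y
      - 139 * x ^ 3 * y ^ 2 + 703 / 3 * x ^ 2 * y ^ 3 - 216 * x * y ^ 4 + 36 * y ^ 5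
      - 16 * x ^ 5 * y + 40 * x ^ 4 * y ^ 2 - 196 / 3 * x ^ 3 * y ^ 3 + 60 * x ^ 2 * y ^ 4
      - 144 / 5 * x * y ^ 5" for x y :: real
  define R where "R x = - 156137 / 192 * x + 3542623 / 1920 * x ^ 2 - 682751 / 288 * x ^ 3 + 119359 / 64 * x ^ 4
      - 26983 / 30 * x ^ 5 + 4447 / 18 * x ^ 6 - 3152 / 105 * x ^ 7" for x :: real
  have "(LINT t|lborel. (piece3 t)\<^sup>2) = R (5 / 4) - R (1)"
  proof (rule region_integral[where p = "\<lambda>x y z. (g_mean y (5 / 4 - x) - 8 + 32 * y)\<^sup>2" and P = P and Q = Q and R = R
        and l = "\<lambda>x. 5 / 4 - x" and u = "\<lambda>x. 1 / 4" and m = "\<lambda>x y. 0" and n = "\<lambda>x y. 5 / 4 - x"])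
    show "tame (\<lambda>t. (piece3 t)\<^sup>2)"
      by (intro tame_power2 tame_pieces)
    show "(P x y has_real_derivative (g_mean y (5 / 4 - x) - 8 + 32 * y)\<^sup>2) (at z)" for x y z
      unfolding P_def by (rule derivative_eq_intros refl | simp)+ (simp add: poly_defs field_simps eval_nat_numeral)
    show "(Q x has_real_derivative P x y (5 / 4 - x) - P x y (0)) (at y)" for x y
      unfolding P_def Q_def by (rule derivative_eq_intros refl | simp)+ (simp add: poly_defs field_simps eval_nat_numeral)
    show "(R has_real_derivative Q x (1 / 4) - Q x (5 / 4 - x)) (at x)" for x
      unfolding Q_def R_def by (rule derivative_eq_intros refl | simp)+ (simp add: poly_defs field_simps eval_nat_numeral)
    show "continuous_on UNIV (\<lambda>z. (g_mean y (5 / 4 - x) - 8 + 32 * y)\<^sup>2)" for x y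
      unfolding poly_defs by (intro continuous_intros)
    show "continuous_on UNIV (\<lambda>y. P x y (5 / 4 - x) - P x y (0))" for x
      unfolding P_def by (intro continuous_intros)
    show "continuous_on UNIV (\<lambda>x. Q x (1 / 4) - Q x (5 / 4 - x))"
      unfolding Q_def by (intro continuous_intros)
  qed (auto simp: piece_apply split: if_splits)
  also have "\<dots> = 415591 / 5160960" by (simp add: R_def eval_nat_numeral)
  finally show ?thesis .
qed

text \<open>The outer bounds are implied: \<open>5 / 4 < x + z\<close> and
  \<open>x + y + z \<le> 3 / 2\<close> give \<open>y < 1 / 4\<close>, and then
  \<open>5 / 4 < x + y\<close> gives \<open>1 < x\<close>.\<close>

lemma integral_sq_piece4: "(LINT t|lborel. (piece4 t)\<^sup>2) = 1919 / 8064"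
proof -
  define P where "P x y z = 2704 * z - 3328 * x * z - 2184 * y * z - 1092 * z ^ 2 + 1024 * x ^ 2 * z
      + 1344 * x * y * z + 672 * x * z ^ 2 + 1689 * y ^ 2 * z + 1481 * y * z ^ 2 + 563 * z ^ 3
      - 768 * x * y ^ 2 * z - 640 * x * y * z ^ 2 - 256 * x * z ^ 3 - 504 * y ^ 3 * z
      - 672 * y ^ 2 * z ^ 2 - 448 * y * z ^ 3 - 126 * z ^ 4 + 144 * y ^ 4 * z
      + 240 * y ^ 3 * z ^ 2 + 688 / 3 * y ^ 2 * z ^ 3 + 120 * y * z ^ 4 + 144 / 5 * z ^ 5" for x y z :: real
  define Q where "Q x y = 336843 / 640 * y - 1010 * x * y - 67409 / 64 * y ^ 2 + 760 * x ^ 2 * y + 1931 * x * y ^ 2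
      + 863 / 18 * y ^ 3 - 264 * x ^ 3 * y - 1435 * x ^ 2 * y ^ 2 + 572 / 3 * x * y ^ 3
      - 138 * y ^ 4 + 36 * x ^ 4 * y + 504 * x ^ 3 * y ^ 2 - 616 / 3 * x ^ 2 * y ^ 3
      + 132 * x * y ^ 4 - 2 / 5 * y ^ 5 - 72 * x ^ 4 * y ^ 2 + 64 * x ^ 3 * y ^ 3
      - 64 * x ^ 2 * y ^ 4 + 128 / 5 * x * y ^ 5 - 316 / 45 * y ^ 6" for x y :: real
  define R where "R x = 1908101 / 1440 * x - 459957 / 160 * x ^ 2 + 111291 / 32 * x ^ 3 - 91909 / 36 * x ^ 4
      + 4583 / 4 * x ^ 5 - 4396 / 15 * x ^ 6 + 10468 / 315 * x ^ 7" for x :: real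
  have "(LINT t|lborel. (piece4 t)\<^sup>2) = R (5 / 4) - R (1)"
  proof (rule region_integral[where p = "\<lambda>x y z. (g_poly y z + 40 - 32 * x)\<^sup>2" and P = P and Q = Q and R = R
        and l = "\<lambda>x. 5 / 4 - x" and u = "\<lambda>x. 1 / 4" and m = "\<lambda>x y. 5 / 4 - x" and n = "\<lambda>x y. 3 / 2 - x - y"])
    show "tame (\<lambda>t. (piece4 t)\<^sup>2)"
      by (intro tame_power2 tame_pieces)
    show "(P x y has_real_derivative (g_poly y z + 40 - 32 * x)\<^sup>2) (at z)" for x y z
      unfolding P_def by (rule derivative_eq_intros refl | simp)+ (simp add: poly_defs field_simps eval_nat_numeral)
    show "(Q x has_real_derivative P x y (3 / 2 - x - y) - P x y (5 / 4 - x)) (at y)" for x y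
      unfolding P_def Q_def by (rule derivative_eq_intros refl | simp)+ (simp add: poly_defs field_simps eval_nat_numeral)
    show "(R has_real_derivative Q x (1 / 4) - Q x (5 / 4 - x)) (at x)" for x
      unfolding Q_def R_def by (rule derivative_eq_intros refl | simp)+ (simp add: poly_defs field_simps eval_nat_numeral)
    show "continuous_on UNIV (\<lambda>z. (g_poly y z + 40 - 32 * x)\<^sup>2)" for x y
      unfolding poly_defs by (intro continuous_intros)
    show "continuous_on UNIV (\<lambda>y. P x y (3 / 2 - x - y) - P x y (5 / 4 - x))" for x
      unfolding P_def by (intro continuous_intros)
    show "continuous_on UNIV (\<lambda>x. Q x (1 / 4) - Q x (5 / 4 - x))"
      unfolding Q_def by (intro continuous_intros)
  qed (auto simp: piece_apply split: if_splits)
  also have "\<dots> = 1919 / 8064" by (simp add: R_def eval_nat_numeral)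
  finally show ?thesis .
qed

lemma integral_sq_piece5: "(LINT t|lborel. (piece5 t)\<^sup>2) = 156161 / 645120"
proof -
  define P where "P x y z = 144 * z - 504 * y * z - 252 * z ^ 2 + 729 * y ^ 2 * z + 681 * y * z ^ 2 + 243 * z ^ 3
      - 504 * y ^ 3 * z - 672 * y ^ 2 * z ^ 2 - 448 * y * z ^ 3 - 126 * z ^ 4 + 144 * y ^ 4 * z
      + 240 * y ^ 3 * z ^ 2 + 688 / 3 * y ^ 2 * z ^ 3 + 120 * y * z ^ 4 + 144 / 5 * z ^ 5" for x y z :: real
  define Q where "Q x y = 999 / 20 * y - 225 / 4 * x * y - 369 / 4 * y ^ 2 + 225 / 2 * x ^ 2 * y + 45 * x * y ^ 2
      + 111 * y ^ 3 - 135 * x ^ 3 * y - 60 * x ^ 2 * y ^ 2 - 32 * x * y ^ 3 - 327 / 4 * y ^ 4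
      + 90 * x ^ 4 * y + 44 * x ^ 3 * y ^ 2 + 28 * x ^ 2 * y ^ 3 + 12 * x * y ^ 4
      + 178 / 5 * y ^ 5 - 144 / 5 * x ^ 5 * y - 12 * x ^ 4 * y ^ 2 - 112 / 9 * x ^ 3 * y ^ 3
      - 4 * x ^ 2 * y ^ 4 - 16 / 5 * x * y ^ 5 - 316 / 45 * y ^ 6" for x y :: real
  define R where "R x = 5913 / 320 * x - 2187 / 80 * x ^ 2 + 363 / 8 * x ^ 3 - 411 / 8 * x ^ 4 + 749 / 20 * x ^ 5
      - 244 / 15 * x ^ 6 + 964 / 315 * x ^ 7" for x :: real
  have "(LINT t|lborel. (piece5 t)\<^sup>2) = R (3 / 2) - R (5 / 4)"
  proof (rule region_integral[where p = "\<lambda>x y z. (g_poly y z)\<^sup>2" and P = P and Q = Q and R = R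
        and l = "\<lambda>x. 0" and u = "\<lambda>x. 3 / 2 - x" and m = "\<lambda>x y. 0" and n = "\<lambda>x y. 3 / 2 - x - y"])
    show "tame (\<lambda>t. (piece5 t)\<^sup>2)"
      by (intro tame_power2 tame_pieces)
    show "(P x y has_real_derivative (g_poly y z)\<^sup>2) (at z)" for x y z
      unfolding P_def by (rule derivative_eq_intros refl | simp)+ (simp add: poly_defs field_simps eval_nat_numeral)
    show "(Q x has_real_derivative P x y (3 / 2 - x - y) - P x y (0)) (at y)" for x y
      unfolding P_def Q_def by (rule derivative_eq_intros refl | simp)+ (simp add: poly_defs field_simps eval_nat_numeral)
    show "(R has_real_derivative Q x (3 / 2 - x) - Q x (0)) (at x)" for x
      unfolding Q_def R_def by (rule derivative_eq_intros refl | simp)+ (simp add: poly_defs field_simps eval_nat_numeral)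
    show "continuous_on UNIV (\<lambda>z. (g_poly y z)\<^sup>2)" for x y
      unfolding poly_defs by (intro continuous_intros)
    show "continuous_on UNIV (\<lambda>y. P x y (3 / 2 - x - y) - P x y (0))" for x
      unfolding P_def by (intro continuous_intros)
    show "continuous_on UNIV (\<lambda>x. Q x (3 / 2 - x) - Q x (0))"
      unfolding Q_def by (intro continuous_intros)
  qed (auto simp: piece_apply split: if_splits)
  also have "\<dots> = 156161 / 645120" by (simp add: R_def eval_nat_numeral)
  finally show ?thesis .
qed

text \<open>The lower bound for \<open>y\<close> is the larger of 5/4 - x and 1/4. It changes over
  at x = 1, hence the two slabs.\<close>

lemma integral_sq_piece2: "(LINT t|lborel. (piece2 t)\<^sup>2) = 23899 / 107520"
proof -
  let ?J = "\<lambda>x. LINT y|lborel. LINT z|lborel. (piece2 (x, y, z))\<^sup>2"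
  define P where "P x y z = 441 / 16 * z - 63 / 4 * x * z - 315 / 4 * y * z + 177 / 4 * x ^ 2 * z + 3 / 2 * x * y * z
      + 477 / 4 * y ^ 2 * z - 12 * x ^ 3 * z - 54 * x ^ 2 * y * z + 12 * x * y ^ 2 * z
      - 90 * y ^ 3 * z + 16 * x ^ 4 * z - 16 * x ^ 3 * y * z + 52 * x ^ 2 * y ^ 2 * z
      - 24 * x * y ^ 3 * z + 36 * y ^ 4 * z" for x y z :: real
  define Q where "Q x y = 1323 / 32 * y - 819 / 16 * x * y - 2331 / 32 * y ^ 2 + 657 / 8 * x ^ 2 * y
      + 387 / 8 * x * y ^ 2 + 687 / 8 * y ^ 3 - 249 / 4 * x ^ 3 * y - 507 / 8 * x ^ 2 * y ^ 2
      - 137 / 4 * x * y ^ 3 - 1017 / 16 * y ^ 4 + 36 * x ^ 4 * y + 21 * x ^ 3 * y ^ 2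
      + 40 * x ^ 2 * y ^ 3 + 21 / 2 * x * y ^ 4 + 144 / 5 * y ^ 5 - 16 * x ^ 5 * y
      - 12 * x ^ 3 * y ^ 3 - 7 * x ^ 2 * y ^ 4 - 12 / 5 * x * y ^ 5 - 6 * y ^ 6" for x y :: real
  have tame: "tame (\<lambda>t. (piece2 t)\<^sup>2)"
    by (intro tame_power2 tame_pieces)
  have P: "(P x y has_real_derivative (g_mean y (3 / 2 - x - y))\<^sup>2) (at z)" for x y z
    unfolding P_def by (rule derivative_eq_intros refl | simp)+ (simp add: poly_defs field_simps eval_nat_numeral)
  have Q: "(Q x has_real_derivative P x y (3 / 2 - x - y) - P x y 0) (at y)" for x y
    unfolding P_def Q_def by (rule derivative_eq_intros refl | simp)+ (simp add: poly_defs field_simps eval_nat_numeral)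
  have contP: "continuous_on UNIV (\<lambda>z. (g_mean y (3 / 2 - x - y))\<^sup>2)" for x y
    unfolding poly_defs by (intro continuous_intros)
  have contQ: "continuous_on UNIV (\<lambda>y. P x y (3 / 2 - x - y) - P x y 0)" for x
    unfolding P_def by (intro continuous_intros)
  define R1 where "R1 x = 22731 / 20480 * x - 12101 / 5120 * x ^ 2 + 2429 / 768 * x ^ 3 - 19 / 8 * x ^ 4
      + 9 / 10 * x ^ 5" for x :: real
  have slab1: "(LINT x|lborel. indicator {3 / 4..1} x * ?J x) = R1 (1) - R1 (3 / 4)"
  proof (rule slab_integral[OF tame, where p = "\<lambda>x y z. (g_mean y (3 / 2 - x - y))\<^sup>2" and P = P and Q = Q and R = R1
        and l = "\<lambda>x. 5 / 4 - x" and u = "\<lambda>x. 3 / 2 - x" and m = "\<lambda>x y. 0" and n = "\<lambda>x y. 3 / 2 - x - y"])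
    show "(R1 has_real_derivative Q x (3 / 2 - x) - Q x (5 / 4 - x)) (at x)" for x
      unfolding Q_def R1_def by (rule derivative_eq_intros refl | simp)+ (simp add: poly_defs field_simps eval_nat_numeral)
    show "continuous_on UNIV (\<lambda>x. Q x (3 / 2 - x) - Q x (5 / 4 - x))"
      unfolding Q_def by (intro continuous_intros)
  qed (use P Q contP contQ in \<open>auto simp: piece_apply split: if_splits\<close>)
  define R2 where "R2 x = 39375 / 4096 * x - 19625 / 1024 * x ^ 2 + 7775 / 256 * x ^ 3 - 2115 / 64 * x ^ 4
      + 1961 / 80 * x ^ 5 - 231 / 20 * x ^ 6 + 87 / 35 * x ^ 7" for x :: real
  have slab2: "(LINT x|lborel. indicator {1..5 / 4} x * ?J x) = R2 (5 / 4) - R2 (1)"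
  proof (rule slab_integral[OF tame, where p = "\<lambda>x y z. (g_mean y (3 / 2 - x - y))\<^sup>2" and P = P and Q = Q and R = R2
        and l = "\<lambda>x. 1 / 4" and u = "\<lambda>x. 3 / 2 - x" and m = "\<lambda>x y. 0" and n = "\<lambda>x y. 3 / 2 - x - y"])
    show "(R2 has_real_derivative Q x (3 / 2 - x) - Q x (1 / 4)) (at x)" for x
      unfolding Q_def R2_def by (rule derivative_eq_intros refl | simp)+ (simp add: poly_defs field_simps eval_nat_numeral)
    show "continuous_on UNIV (\<lambda>x. Q x (3 / 2 - x) - Q x (1 / 4))"
      unfolding Q_def by (intro continuous_intros)
  qed (use P Q contP contQ in \<open>auto simp: piece_apply split: if_splits\<close>)
  have tameJ: "tame ?J"
    using tame_marginal[OF tame] tame_Fubini(1)[OF tame_section[OF tame]] by simp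
  have int: "integrable lborel (\<lambda>x. indicator A x * ?J x)" if "A \<in> sets lborel" for A
    using integrable_real_mult_indicator[OF that tame_integrable[OF tameJ]] by (simp only: mult.commute)
  have zero: "?J x = 0" if "x < 3 / 4 \<or> 5 / 4 < x" for x
  proof -
    have "piece2 (x, y, z) = 0" for y z
      unfolding piece_apply by (rule if_not_P) (use that in linarith)
    then show ?thesis by simp
  qed
  have "(LINT t|lborel. (piece2 t)\<^sup>2) = (LINT x|lborel. ?J x)"
    by (rule tame_Fubini3[OF tame])
  \<comment> \<open>Both slabs contain x = 1, so the equality holds only almost everywhere.\<close>
  also have "\<dots> = (LINT x|lborel. indicator {3 / 4..1} x * ?J x + indicator {1..5 / 4} x * ?J x)"
  proof (rule integral_cong_AE)
    show "AE x in lborel. ?J x = indicator {3 / 4..1} x * ?J x + indicator {1..5 / 4} x * ?J x"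
      using AE_lborel_singleton[of 1]
    proof eventually_elim
      case (elim x)
      show ?case
      proof (cases "x < 3 / 4 \<or> 5 / 4 < x")
        case True
        then show ?thesis by (simp only: zero mult_zero_right add_0)
      next
        case False
        then show ?thesis using elim by (auto simp: indicator_def)
      qed
    qed
    show "?J \<in> borel_measurable lborel"
      using tame_measurable[OF tameJ] by simp
    show "(\<lambda>x. indicator {3 / 4..1} x * ?J x + indicator {1..5 / 4} x * ?J x) \<in> borel_measurable lborel"
      by (intro borel_measurable_add borel_measurable_integrable int) auto
  qed
  also have "\<dots> = R1 1 - R1 (3 / 4) + (R2 (5 / 4) - R2 1)"
    unfolding slab1[symmetric] slab2[symmetric] by (intro Bochner_Integration.integral_add int) auto
  also have "\<dots> = 23899 / 107520" by (simp add: R1_def R2_def eval_nat_numeral)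
  finally show ?thesis .
qed

text \<open>This is \<open>g\<close> extended by zero off \<open>T\<close>, which turns integrals
  over \<open>T\<close> into integrals over the plane.\<close>

definition g_triangle :: "real \<times> real \<Rightarrow> real" where
  "g_triangle s = (if 0 \<le> fst s \<and> 0 \<le> snd s \<and> fst s + snd s \<le> 3 / 4 then g_poly (fst s) (snd s) else 0)"

lemma tame_g_triangle: "tame g_triangle"
proof -
  have [measurable]: "fst \<in> borel_measurable (borel :: (real \<times> real) measure)"
    "snd \<in> borel_measurable (borel :: (real \<times> real) measure)"
    by (intro borel_measurable_continuous_onI continuous_intros)+
  have *: "tame (\<lambda>t. if C t then p t else 0)"
    if "continuous_on UNIV p" "Measurable.pred borel C" "\<And>t. C t \<Longrightarrow> t \<in> cbox (0, 0) (2, 2)"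
    for C :: "real \<times> real \<Rightarrow> bool" and p using tame_if[OF that] .
  show ?thesis
    unfolding g_triangle_def[abs_def] poly_defs
    by (rule *, (intro continuous_intros; simp), measurable, (auto simp: cbox_Pair_eq)[1])
qed

lemma integral_sq_g_triangle: "(LINT s|lborel. (g_triangle s)\<^sup>2) = 18549 / 2560"
proof -
  define Q where "Q x y = 144 * y - 504 * x * y - 252 * y ^ 2 + 729 * x ^ 2 * y + 681 * x * y ^ 2 + 243 * y ^ 3
      - 504 * x ^ 3 * y - 672 * x ^ 2 * y ^ 2 - 448 * x * y ^ 3 - 126 * y ^ 4 + 144 * x ^ 4 * y
      + 240 * x ^ 3 * y ^ 2 + 688 / 3 * x ^ 2 * y ^ 3 + 120 * x * y ^ 4 + 144 / 5 * y ^ 5" for x y :: real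
  define R where "R x = 22869 / 640 * x - 4959 / 64 * x ^ 2 + 195 / 2 * x ^ 3 - 75 * x ^ 4 + 166 / 5 * x ^ 5
      - 316 / 45 * x ^ 6" for x :: real
  note tame = tame_power2[OF tame_g_triangle]
  have Q: "(Q x has_real_derivative (g_poly x y)\<^sup>2) (at y)" for x y
    unfolding Q_def by (rule derivative_eq_intros refl | simp)+ (simp add: poly_defs field_simps eval_nat_numeral)
  have contQ: "continuous_on UNIV (\<lambda>y. (g_poly x y)\<^sup>2)" for x
    unfolding poly_defs by (intro continuous_intros)
  have R: "(R has_real_derivative Q x (3 / 4 - x) - Q x 0) (at x)" for x
    unfolding Q_def R_def by (rule derivative_eq_intros refl | simp)+ (simp add: poly_defs field_simps eval_nat_numeral)
  have contR: "continuous_on UNIV (\<lambda>x. Q x (3 / 4 - x) - Q x 0)"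
    unfolding Q_def by (intro continuous_intros)
  have inner: "(LINT y|lborel. (g_triangle (x, y))\<^sup>2) = Q x (3 / 4 - x) - Q x 0" if "0 < x" "x < 3 / 4" for x
    by (rule lborel_integral_antiderivative[OF _ Q contQ tame_measurable[OF tame_section[OF tame]]])
       (use that in \<open>auto simp: g_triangle_def\<close>)
  have "(LINT s|lborel. (g_triangle s)\<^sup>2) = (LINT x|lborel. LINT y|lborel. (g_triangle (x, y))\<^sup>2)"
    by (rule tame_Fubini(1)[OF tame])
  also have "\<dots> = R (3 / 4) - R 0"
  proof (rule lborel_integral_antiderivative[OF _ R contR tame_measurable[OF tame_marginal[OF tame]]])
    show "(LINT y|lborel. (g_triangle (x, y))\<^sup>2) = 0" if "x < 0 \<or> 3 / 4 < x" for x
    proof -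
      have "g_triangle (x, y) = 0" for y using that by (auto simp: g_triangle_def)
      then show ?thesis by simp
    qed
  qed (use inner in auto)
  also have "\<dots> = 18549 / 2560" by (simp add: R_def eval_nat_numeral)
  finally show ?thesis .
qed

subsection \<open>The variational inequality\<close>

lemma F0_nonzero:
  assumes "F0 (x, y, z) \<noteq> 0"
  shows "0 \<le> x \<and> 0 \<le> y \<and> 0 \<le> z \<and> x + y + z \<le> 3 / 2"
  using F0_support[of x y z] assms by linarith

lemma integral_cyc:
  assumes "tame f" shows "(LINT t|lborel. cyc f t) = 3 * (LINT t|lborel. f t)"
proof -
  note t = tame_permute(1)[OF assms]
  note i = tame_integrable[OF assms] tame_integrable[OF t] tame_integrable[OF tame_permute(1)[OF t]]
  show ?thesis
    unfolding cyc_def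
    using i integral_permute(1)[OF assms] integral_permute(1)[OF t] by simp
qed

lemma power2_add_disjoint:
  fixes a b :: real assumes "a * b = 0" shows "(a + b)\<^sup>2 = a\<^sup>2 + b\<^sup>2"
  using assms by (simp add: power2_sum)

text \<open>No point lies in two pieces, so there are no cross terms. In \<open>piece1\<close> the
  coordinate \<open>x\<close> is below 1/4, in the others above 3/4; these are told apart by
  comparing \<open>x\<close>, \<open>x + y\<close>, \<open>x + z\<close> with 5/4 and
  \<open>y\<close>, \<open>z\<close> with 1/4.\<close>

lemma correction_disjoint:
  fixes x y z :: real
  defines "t \<equiv> (x, y, z)"
  shows "(correction t)\<^sup>2 = (piece1 t)\<^sup>2 + (piece2 t)\<^sup>2 + (piece2 (flip t))\<^sup>2 + (piece3 t)\<^sup>2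
    + (piece3 (flip t))\<^sup>2 + (piece4 t)\<^sup>2 + (piece5 t)\<^sup>2"
proof -
  have zero:
    "piece1 t * piece2 t = 0"
    "piece1 t * piece2 (flip t) = 0" "piece2 t * piece2 (flip t) = 0"
    "piece1 t * piece3 t = 0" "piece2 t * piece3 t = 0" "piece2 (flip t) * piece3 t = 0"
    "piece1 t * piece3 (flip t) = 0" "piece2 t * piece3 (flip t) = 0"
    "piece2 (flip t) * piece3 (flip t) = 0" "piece3 t * piece3 (flip t) = 0"
    "piece1 t * piece4 t = 0" "piece2 t * piece4 t = 0" "piece2 (flip t) * piece4 t = 0"
    "piece3 t * piece4 t = 0" "piece3 (flip t) * piece4 t = 0"
    "piece1 t * piece5 t = 0" "piece2 t * piece5 t = 0" "piece2 (flip t) * piece5 t = 0"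
    "piece3 t * piece5 t = 0" "piece3 (flip t) * piece5 t = 0" "piece4 t * piece5 t = 0"
    unfolding t_def flip_simp piece_apply by auto
  show ?thesis
    unfolding correction_def by (simp add: power2_add_disjoint distrib_right zero)
qed

text \<open>The distinguished coordinate can be recovered from the point: either it alone exceeds
  3/4, or none does and it alone is below 1/4. Hence no two cyclic copies of
  \<open>correction\<close> are nonzero at the same point.\<close>

lemma correction_region:
  assumes "correction (x, y, z) \<noteq> 0"
  shows "3 / 4 < x \<and> 0 \<le> y \<and> 0 \<le> z \<and> x + y + z \<le> 3 / 2 \<or> x < 1 / 4 \<and> 1 / 2 < y \<and> 1 / 2 < z \<and> y \<le> 3 / 4 \<and> z \<le> 3 / 4"
proof (rule ccontr)
  assume n: "\<not> ?thesis"
  have "piece1 (x, y, z) = 0" "piece2 (x, y, z) = 0" "piece2 (x, z, y) = 0" "piece3 (x, y, z) = 0"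
    "piece3 (x, z, y) = 0" "piece4 (x, y, z) = 0" "piece5 (x, y, z) = 0"
    unfolding piece_apply by (rule if_not_P; use n in linarith)+
  then show False using assms by (simp add: correction_def)
qed

lemma cyc_correction_square: "(cyc correction t)\<^sup>2 = cyc (\<lambda>t. (correction t)\<^sup>2) t"
proof -
  obtain x y z where t: "t = (x, y, z)" by (metis surj_pair)
  have zero: "correction (x, y, z) * correction (y, z, x) = 0"
    "correction (x, y, z) * correction (z, x, y) = 0" "correction (y, z, x) * correction (z, x, y) = 0"
    using correction_region[of x y z] correction_region[of y z x] correction_region[of z x y]
    unfolding mult_eq_0_iff by linarith+
  show ?thesis by (simp add: t cyc_def power2_add_disjoint distrib_right zero)
qed

lemma integral_sq_correction:
  "(LINT t|lborel. (cyc correction t)\<^sup>2) = 3 * ((LINT t|lborel. (piece1 t)\<^sup>2) + 2 * (LINT t|lborel. (piece2 t)\<^sup>2)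
     + 2 * (LINT t|lborel. (piece3 t)\<^sup>2) + (LINT t|lborel. (piece4 t)\<^sup>2) + (LINT t|lborel. (piece5 t)\<^sup>2))"
proof -
  note sq = tame_pieces[THEN tame_power2]
  note i = sq[THEN tame_integrable] sq[THEN tame_permute(2), THEN tame_integrable]
  have "(LINT t|lborel. (cyc correction t)\<^sup>2) = 3 * (LINT t|lborel. (correction t)\<^sup>2)"
    unfolding cyc_correction_square by (rule integral_cyc[OF tame_power2[OF tame_correction]])
  also have "(\<lambda>t. (correction t)\<^sup>2) = (\<lambda>t. (piece1 t)\<^sup>2 + (piece2 t)\<^sup>2 + (piece2 (flip t))\<^sup>2 + (piece3 t)\<^sup>2
    + (piece3 (flip t))\<^sup>2 + (piece4 t)\<^sup>2 + (piece5 t)\<^sup>2)"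
    using correction_disjoint by auto
  also have "(LINT t|lborel. (piece1 t)\<^sup>2 + (piece2 t)\<^sup>2 + (piece2 (flip t))\<^sup>2 + (piece3 t)\<^sup>2
    + (piece3 (flip t))\<^sup>2 + (piece4 t)\<^sup>2 + (piece5 t)\<^sup>2) =
    (LINT t|lborel. (piece1 t)\<^sup>2) + 2 * (LINT t|lborel. (piece2 t)\<^sup>2)
     + 2 * (LINT t|lborel. (piece3 t)\<^sup>2) + (LINT t|lborel. (piece4 t)\<^sup>2) + (LINT t|lborel. (piece5 t)\<^sup>2)"
    using i integral_permute(2)[OF sq(3)] integral_permute(2)[OF sq(4)] by simp
  finally show ?thesis .
qed

text \<open>By rotation the three squares have a common integral, and so have the three products;
  both are brought into the rotated forms evaluated above.\<close>

lemma integral_sq_piece_sum: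
  "(LINT t|lborel. (cyc piece_g t)\<^sup>2) =
     3 * (LINT t|lborel. (piece_g (rot (rot t)))\<^sup>2) + 6 * (LINT t|lborel. piece_g (rot t) * piece_g (rot (rot t)))"
proof -
  define c where "c t = piece_g t * piece_g (rot t)" for t
  note g = tame_pieces(1)
  have tame: "tame (\<lambda>t. (piece_g t)\<^sup>2)" "tame c"
    unfolding c_def[abs_def] by (intro tame_power2 tame_mult g tame_permute(1))+
  have "(cyc piece_g t)\<^sup>2 = cyc (\<lambda>t. (piece_g t)\<^sup>2) t + 2 * cyc c t" for t
    by (cases t) (simp add: cyc_def c_def power2_eq_square algebra_simps)
  then have "(LINT t|lborel. (cyc piece_g t)\<^sup>2) = 3 * (LINT t|lborel. (piece_g t)\<^sup>2) + 2 * (3 * (LINT t|lborel. c t))"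
    using integral_cyc[OF tame(1)] integral_cyc[OF tame(2)]
      tame_integrable[OF tame_cyc[OF tame(1)]] tame_integrable[OF tame_cyc[OF tame(2)]] by simp
  also have "(LINT t|lborel. c t) = (LINT t|lborel. piece_g (rot t) * piece_g (rot (rot t)))"
    using integral_permute(1)[OF tame(2)] by (simp add: c_def)
  also have "(LINT t|lborel. (piece_g t)\<^sup>2) = (LINT t|lborel. (piece_g (rot (rot t)))\<^sup>2)"
    using integral_permute(1)[OF tame(1)] integral_permute(1)[OF tame_permute(1)[OF tame(1)]] by simp
  finally show ?thesis by simp
qed

text \<open>The integrated variable comes first, to match the distinguished coordinate of
  \<open>piece_g\<close>; by symmetry of \<open>F0\<close> the choice is immaterial.\<close>

definition marginal :: "real \<times> real \<Rightarrow> real" where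
  "marginal s = (LINT x|lborel. F0 (x, s))"

lemma tame_marginal_F0: "tame marginal"
  unfolding marginal_def[abs_def] using tame_marginal[OF tame_swap[OF tame_F0]] by simp

lemma F0_cyc: "F0 t = F0 (rot t)"
  by (cases t) (simp add: F0_rot)

text \<open>\<open>F0\<close> is invariant under \<open>rot\<close>, so it has the same inner
  product with all three summands of \<open>S\<close>. In \<open>piece_g\<close> the value depends
  on the last two coordinates only, and the first integrates out to \<open>marginal\<close>.\<close>

lemma integral_F0_piece_sum:
  "(LINT t|lborel. F0 t * cyc piece_g t) = 3 * (LINT s|lborel. marginal s * g_triangle s)"
proof -
  have tame: "tame (\<lambda>t. F0 t * piece_g t)" by (intro tame_mult tame_F0 tame_pieces)
  have "F0 t * cyc piece_g t = cyc (\<lambda>t. F0 t * piece_g t) t" for t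
    by (simp add: cyc_def F0_cyc[symmetric] distrib_left)
  then have "(LINT t|lborel. F0 t * cyc piece_g t) = 3 * (LINT t|lborel. F0 t * piece_g t)"
    using integral_cyc[OF tame] by simp
  also have "(LINT t|lborel. F0 t * piece_g t) = (LINT s|lborel. LINT x|lborel. F0 (x, s) * piece_g (x, s))"
    by (rule tame_Fubini(2)[OF tame])
  also have "\<dots> = (LINT s|lborel. LINT x|lborel. F0 (x, s) * g_triangle s)"
  proof -
    \<comment> \<open>Where \<open>F0\<close> is nonzero, \<open>0 \<le> x\<close> and
      \<open>x + y + z \<le> 3 / 2\<close> hold, so the restriction of \<open>piece_g\<close> to
      \<open>R\<close> is absorbed.\<close>
    have "F0 (x, s) * piece_g (x, s) = F0 (x, s) * g_triangle s" for x s
    proof -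
      obtain y z where s: "s = (y, z)" by (metis surj_pair)
      show ?thesis
        using F0_nonzero[of x y z] unfolding s g_triangle_def piece_apply by auto
    qed
    then show ?thesis by (simp only:)
  qed
  also have "\<dots> = (LINT s|lborel. marginal s * g_triangle s)"
    by (simp add: marginal_def)
  finally show ?thesis .
qed

definition triangle :: "(real \<times> real) set" where
  "triangle = {(t1, t2). 0 \<le> t1 \<and> 0 \<le> t2 \<and> t1 + t2 \<le> 3 / 4}"

lemma closed_triangle: "closed triangle"
proof -
  have "triangle = {s. 0 \<le> fst s \<and> 0 \<le> snd s \<and> fst s + snd s \<le> 3 / 4}" by (auto simp: triangle_def)
  also have "closed \<dots>" by (intro closed_Collect_conj closed_Collect_le continuous_intros)
  finally show ?thesis .
qed

text \<open>On \<open>triangle\<close> the pointwise bound says that the square of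
  \<open>marginal s - 2 * g_triangle s\<close> is nonnegative; elsewhere both sides are 0.\<close>

lemma marginal_ge:
  "4 * (LINT s|lborel. marginal s * g_triangle s) - 4 * (LINT s|lborel. (g_triangle s)\<^sup>2)
     \<le> (LINT s:triangle|lborel. (marginal s)\<^sup>2)"
proof -
  note t = tame_mult[OF tame_marginal_F0 tame_g_triangle] tame_power2[OF tame_g_triangle]
  have "4 * (LINT s|lborel. marginal s * g_triangle s) - 4 * (LINT s|lborel. (g_triangle s)\<^sup>2)
    = (LINT s|lborel. 4 * (marginal s * g_triangle s) - 4 * (g_triangle s)\<^sup>2)"
    using t[THEN tame_integrable] by simp
  also have "\<dots> \<le> (LINT s|lborel. indicator triangle s *\<^sub>R (marginal s)\<^sup>2)"
  proof (rule integral_mono)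
    show "integrable lborel (\<lambda>s. 4 * (marginal s * g_triangle s) - 4 * (g_triangle s)\<^sup>2)"
      using t[THEN tame_integrable] by simp
    show "integrable lborel (\<lambda>s. indicator triangle s *\<^sub>R (marginal s)\<^sup>2)"
      using tame_integrable[OF tame_power2[OF tame_marginal_F0]] closed_triangle
      by (intro integrable_mult_indicator) auto
    show "4 * (marginal s * g_triangle s) - 4 * (g_triangle s)\<^sup>2 \<le> indicator triangle s *\<^sub>R (marginal s)\<^sup>2"
      if "s \<in> space lborel" for s
    proof (cases "s \<in> triangle")
      case True
      have "0 \<le> (marginal s - 2 * g_triangle s)\<^sup>2" by simp
      then show ?thesis using True by (simp add: power2_eq_square algebra_simps)
    next
      case False
      then have "g_triangle s = 0" by (auto simp: triangle_def g_triangle_def split: prod.splits)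
      then show ?thesis using False by simp
    qed
  qed
  finally show ?thesis by (simp add: set_lebesgue_integral_def)
qed

text \<open>\<open>F0\<close> vanishes when a coordinate is negative, so the half line carries the
  whole integral.\<close>

lemma marginal_eq: "(LINT t3:{0..}|lborel. F0 (t1, t2, t3)) = marginal (t1, t2)"
proof -
  have "indicator {0..} t3 *\<^sub>R F0 (t1, t2, t3) = F0 (t3, t1, t2)" for t3
    using F0_nonzero[of t1 t2 t3]
    unfolding F0_rot[where x = t3 and y = t1 and z = t2, symmetric] by (auto simp: indicator_def)
  then show ?thesis by (simp add: set_lebesgue_integral_def marginal_def)
qed

lemma marginal_zero:
  assumes "0 \<le> t1" "0 \<le> t2" "5 / 4 < t1 + t2"
  shows "marginal (t1, t2) = 0"
proof -
  have "marginal (t1, t2) = (LINT z|lborel. F0 (t1, t2, z))"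
    by (simp add: marginal_def F0_rot)
  moreover have "(LINT z|lborel. F0 (t1, t2, z)) = (LINT z|lborel. F0 (t2, t1, z))"
    by (simp add: F0_swap)
  ultimately show ?thesis
    using marginal_F0[of t2 t1] marginal_F0[of t1 t2] assms by (cases "t2 \<le> t1") (auto simp: add.commute)
qed

lemma integral_octant: "(LINT t:octant|lborel. (F0 t)\<^sup>2) = (LINT t|lborel. (F0 t)\<^sup>2)"
proof -
  have "indicator octant t *\<^sub>R (F0 t)\<^sup>2 = (F0 t)\<^sup>2" for t
  proof -
    obtain x y z where "t = (x, y, z)" by (metis surj_pair)
    then show ?thesis using F0_nonzero[of x y z] by (auto simp: octant_def indicator_def)
  qed
  then show ?thesis by (simp only: set_lebesgue_integral_def)
qed

lemma energy_gap:
  "2 * (LINT t|lborel. F0 t * cyc piece_g t) - (LINT t|lborel. (F0 t)\<^sup>2)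
     = (LINT t|lborel. (cyc piece_g t)\<^sup>2) - (LINT t|lborel. (cyc correction t)\<^sup>2)"
proof -
  have "2 * (F0 t * cyc piece_g t) - (F0 t)\<^sup>2 = (cyc piece_g t)\<^sup>2 - (cyc correction t)\<^sup>2" for t
    by (simp add: F0_def power2_eq_square algebra_simps)
  then have "(LINT t|lborel. 2 * (F0 t * cyc piece_g t) - (F0 t)\<^sup>2) =
    (LINT t|lborel. (cyc piece_g t)\<^sup>2 - (cyc correction t)\<^sup>2)" by simp
  moreover have tame: "tame (\<lambda>t. F0 t * cyc piece_g t)" "tame (\<lambda>t. (F0 t)\<^sup>2)"
    "tame (\<lambda>t. (cyc piece_g t)\<^sup>2)" "tame (\<lambda>t. (cyc correction t)\<^sup>2)"
    by (intro tame_mult tame_power2 tame_F0 tame_cyc tame_pieces tame_correction)+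
  ultimately show ?thesis using tame[THEN tame_integrable] by simp
qed

text \<open>Numerically the left side is about 43.474 and the right side about 46.908 - 3.408 =
  43.500. The margin of 0.026 is below one percent of the norm of \<open>E\<close> squared, which
  limits how crude the trial function may be.\<close>

lemma energy_gap_gt:
  "6 * (LINT s|lborel. (g_triangle s)\<^sup>2)
     < (LINT t|lborel. (cyc piece_g t)\<^sup>2) - (LINT t|lborel. (cyc correction t)\<^sup>2)"
  using integral_permute(1)[OF tame_power2[OF tame_pieces(2)]]
    integral_permute(1)[OF tame_permute(1)[OF tame_power2[OF tame_pieces(2)]]]
  unfolding integral_sq_piece_sum integral_sq_correction integral_sq_piece_g integral_cross_piece_g
    integral_sq_piece2 integral_sq_piece3 integral_sq_piece4 integral_sq_piece5 integral_sq_g_triangle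
    integral_sq_piece1
  by simp

text \<open>A nonzero value at one point says nothing about the integral. Instead, a zero norm would
  make the left side of \<open>energy_gap\<close> vanish, while \<open>energy_gap_gt\<close> forces
  it to be positive.\<close>

lemma norm_F0_pos: "0 < (LINT t|lborel. (F0 t)\<^sup>2)"
proof (rule ccontr)
  assume "\<not> ?thesis"
  moreover have "0 \<le> (LINT t|lborel. (F0 t)\<^sup>2)" by simp
  ultimately have zero: "(LINT t|lborel. (F0 t)\<^sup>2) = 0" by linarith
  then have "AE t in lborel. (F0 t)\<^sup>2 = 0"
    using integral_nonneg_eq_0_iff_AE[OF tame_integrable[OF tame_power2[OF tame_F0]]] by simp
  then have "(LINT t|lborel. F0 t * cyc piece_g t) = 0"
    by (intro integral_eq_zero_AE) auto
  moreover have "0 \<le> (LINT s|lborel. (g_triangle s)\<^sup>2)" by simp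
  ultimately show False using energy_gap energy_gap_gt zero by linarith
qed

theorem theorem3p15:
  fixes \<epsilon> :: real
  assumes "\<epsilon> = 1 / 4"
  shows "\<exists>F :: real \<times> real \<times> real \<Rightarrow> real.
    piecewise_polynomial_on octant F \<and>
    closure {t \<in> octant. F t \<noteq> 0} \<subseteq> {(t1, t2, t3) \<in> octant. t1 + t2 + t3 \<le> 3 / 2} \<and>
    symmetric_on_octant F \<and>
    (\<exists>t\<in>octant. F t \<noteq> 0) \<and>
    (\<forall>t1 t2. 0 \<le> t1 \<and> 0 \<le> t2 \<and> t1 + t2 > 1 + \<epsilon> \<longrightarrow>
       (LINT t3:{0..}|lborel. F (t1, t2, t3)) = 0) \<and>
    3 * (LINT s:{(t1, t2). 0 \<le> t1 \<and> 0 \<le> t2 \<and> t1 + t2 \<le> 1 - \<epsilon>}|lborel.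
           (LINT t3:{0..}|lborel. F (fst s, snd s, t3))\<^sup>2)
      / (LINT t:octant|lborel. (F t)\<^sup>2) > 2"
proof (intro exI[of _ F0] conjI)
  show "\<exists>t\<in>octant. F0 t \<noteq> 0"
    by (intro bexI[of _ "(0, 0, 0)"]) (auto simp: F0_origin octant_def)
  show "\<forall>t1 t2. 0 \<le> t1 \<and> 0 \<le> t2 \<and> t1 + t2 > 1 + \<epsilon> \<longrightarrow> (LINT t3:{0..}|lborel. F0 (t1, t2, t3)) = 0"
    using marginal_zero assms by (simp add: marginal_eq)
  \<comment> \<open>With J the marginal and integrals over \<open>triangle\<close>: 3 int J^2 >= 12
    int J g - 12 int g^2 = 4 <F, S> - 12 int g^2, and the energy gap makes this larger than twice
    the squared norm of \<open>F0\<close>.\<close>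
  have "2 * (LINT t|lborel. (F0 t)\<^sup>2) < 3 * (LINT s:triangle|lborel. (marginal s)\<^sup>2)"
    using marginal_ge energy_gap energy_gap_gt integral_F0_piece_sum by linarith
  then have "2 < 3 * (LINT s:triangle|lborel. (marginal s)\<^sup>2) / (LINT t:octant|lborel. (F0 t)\<^sup>2)"
    using norm_F0_pos by (simp add: integral_octant field_simps)
  moreover have "{(t1, t2). 0 \<le> t1 \<and> 0 \<le> t2 \<and> t1 + t2 \<le> 1 - \<epsilon>} = triangle"
    by (auto simp: triangle_def assms)
  ultimately show "3 * (LINT s:{(t1, t2). 0 \<le> t1 \<and> 0 \<le> t2 \<and> t1 + t2 \<le> 1 - \<epsilon>}|lborel.
           (LINT t3:{0..}|lborel. F0 (fst s, snd s, t3))\<^sup>2)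
      / (LINT t:octant|lborel. (F0 t)\<^sup>2) > 2"
    by (simp add: marginal_eq)
qed (fact piecewise_polynomial_F0 closure_support_F0 symmetric_F0)+

end
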